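(* Let $X$ be a Tychonoff space and let $L(X)$ be the free locally convex space over $X$. The following assertions are equivalent: (i) $L(X)$ (viewed as an abelian topological group under addition) is a Mackey group; (ii) $L(X)$ is a Mackey space; (iii) $X$ is discrete.
   Context: All vector spaces are real. Free locally convex space: $L(X)$ is a locally convex space together with a continuous map $i:X\to L(X)$ such that for every continuous map $f$ from $X$ to a locally convex space $E$ there is a unique continuous linear operator $\bar f:L(X)\to E$ with $f=\bar f\circ i$. It always exists and is essentially unique; $X$ (identified with $i(X)$) is a Hamel basis of $L(X)$ and $i$ is a topological embedding. Mackey space: for a locally convex space $(E,\tau)$, a locally convex vector topology $\nu$ on $E$ is compatible with $\tau$ if $(E,\tau)$ and $(E,\nu)$ have the same topological dual space. By the Mackey--Arens theorem there is a finest locally convex vector topology $\mu$ on $E$ compatible with $\tau$; $(E,\tau)$ is a Mackey space if $\mu=\tau$. Mackey group: let $\mathbb{S}$ be the unit circle group and $\mathbb{S}_+=\{z\in\mathbb{S}:\mathrm{Re}(z)\ge 0\}$. For an abelian topological group $(G,\tau)$, $\widehat{(G,\tau)}$ is the group of all continuous characters, i.e. continuous homomorphisms $G\to\mathbb{S}$. A subset $A\subseteq G$ is quasi-convex if for every $g\in G\setminus A$ there is $\chi\in\widehat{G}$ with $\chi(g)\notin\mathbb{S}_+$ and $\chi(A)\subseteq\mathbb{S}_+$. $G$ is locally quasi-convex if it has a neighborhood base at $0$ consisting of quasi-convex sets (every real locally convex space is a locally quasi-convex group). Two group topologies $\mu,\nu$ on $G$ are compatible if $\widehat{(G,\mu)}=\widehat{(G,\nu)}$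 (as sets of homomorphisms $G\to\mathbb{S}$). A locally quasi-convex abelian group $(G,\mu)$ is a Mackey group if every locally quasi-convex group topology $\nu$ on $G$ compatible with $\mu$ satisfies $\nu\le\mu$ (i.e. $\nu\subseteq\mu$). *)

theory Defs
  imports "HOL-Analysis.Analysis" "HOL-Library.Poly_Mapping"
begin

text \<open>
  Spaces whose topology has to vary are represented by a value \<open>T\<close> of type \<open>'v topology\<close>, the
  underlying vector space or group being \<open>topspace T\<close> with the operations of \<open>'v\<close>. Neither
  locally convex spaces nor topological groups are required to be Hausdorff.
  Maps defined on such a space are taken to be \<open>extensional\<close> whenever their identity matters.
\<close>

section \<open>Locally convex spaces and Mackey spaces\<close>

definition locally_convex_space :: "'v::real_vector topology \<Rightarrow> bool" where
  "locally_convex_space T \<longleftrightarrow>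
     subspace (topspace T) \<and>
     continuous_map (prod_topology T T) T (\<lambda>(x, y). x + y) \<and>
     continuous_map (prod_topology euclideanreal T) T (\<lambda>(c, x). c *\<^sub>R x) \<and>
     neighbourhood_base_at 0 convex T"

definition linear_map_on :: "'v::real_vector set \<Rightarrow> ('v \<Rightarrow> 'w::real_vector) \<Rightarrow> bool" where
  "linear_map_on V f \<longleftrightarrow>
     (\<forall>x\<in>V. \<forall>y\<in>V. f (x + y) = f x + f y) \<and> (\<forall>c. \<forall>x\<in>V. f (c *\<^sub>R x) = c *\<^sub>R f x)"

definition topological_dual :: "'v::real_vector topology \<Rightarrow> ('v \<Rightarrow> real) set" where
  "topological_dual T =
     {f \<in> extensional (topspace T). linear_map_on (topspace T) f \<and> continuous_map T euclideanreal f}"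

definition lcs_compatible :: "'v::real_vector topology \<Rightarrow> 'v topology \<Rightarrow> bool" where
  "lcs_compatible T N \<longleftrightarrow>
     locally_convex_space N \<and> topspace N = topspace T \<and> topological_dual N = topological_dual T"

definition finer_than :: "'v topology \<Rightarrow> 'v topology \<Rightarrow> bool" where
  "finer_than M N \<longleftrightarrow> (\<forall>U. openin N U \<longrightarrow> openin M U)"

definition is_mackey_topology :: "'v::real_vector topology \<Rightarrow> 'v topology \<Rightarrow> bool" where
  "is_mackey_topology T M \<longleftrightarrow>
     lcs_compatible T M \<and> (\<forall>N. lcs_compatible T N \<longrightarrow> finer_than M N)"

definition mackey_space :: "'v::real_vector topology \<Rightarrow> bool" where
  "mackey_space T \<longleftrightarrow> locally_convex_space T \<and> is_mackey_topology T T"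

section \<open>Locally quasi-convex groups and Mackey groups\<close>

definition abelian_topological_group :: "'g::ab_group_add topology \<Rightarrow> bool" where
  "abelian_topological_group T \<longleftrightarrow>
     0 \<in> topspace T \<and>
     continuous_map (prod_topology T T) T (\<lambda>(x, y). x + y) \<and>
     continuous_map T T uminus"

abbreviation unit_circle :: "complex set" where
  "unit_circle \<equiv> sphere 0 1"

definition right_half_circle :: "complex set" where
  "right_half_circle = {z \<in> unit_circle. Re z \<ge> 0}"

definition characters :: "'g::ab_group_add topology \<Rightarrow> ('g \<Rightarrow> complex) set" where
  "characters T =
     {\<phi> \<in> extensional (topspace T).
        (\<forall>x\<in>topspace T. \<forall>y\<in>topspace T. \<phi> (x + y) = \<phi> x * \<phi> y) \<and>
        continuous_map T (top_of_set unit_circle) \<phi>}"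

definition quasi_convex :: "'g::ab_group_add topology \<Rightarrow> 'g set \<Rightarrow> bool" where
  "quasi_convex T A \<longleftrightarrow>
     A \<subseteq> topspace T \<and>
     (\<forall>g\<in>topspace T - A. \<exists>\<phi>\<in>characters T. \<phi> g \<notin> right_half_circle \<and> \<phi> ` A \<subseteq> right_half_circle)"

definition locally_quasi_convex :: "'g::ab_group_add topology \<Rightarrow> bool" where
  "locally_quasi_convex T \<longleftrightarrow>
     abelian_topological_group T \<and> neighbourhood_base_at 0 (quasi_convex T) T"

definition mackey_group :: "'g::ab_group_add topology \<Rightarrow> bool" where
  "mackey_group T \<longleftrightarrow>
     locally_quasi_convex T \<and>
     (\<forall>N. locally_quasi_convex N \<and> topspace N = topspace T \<and> characters N = characters T
        \<longrightarrow> finer_than T N)"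

section \<open>The free locally convex space\<close>

instantiation poly_mapping :: (type, real_vector) real_vector
begin

definition scaleR_poly_mapping :: "real \<Rightarrow> ('a \<Rightarrow>\<^sub>0 'b) \<Rightarrow> ('a \<Rightarrow>\<^sub>0 'b)" where
  "scaleR_poly_mapping c p = Poly_Mapping.map (\<lambda>y. c *\<^sub>R y) p"

lemma lookup_scaleR [simp]:
  "Poly_Mapping.lookup (c *\<^sub>R p) x = c *\<^sub>R Poly_Mapping.lookup (p :: 'a \<Rightarrow>\<^sub>0 'b) x"
  by (simp add: scaleR_poly_mapping_def Poly_Mapping.map.rep_eq when_def)

instance
  by standard (simp_all add: poly_mapping_eq_iff fun_eq_iff lookup_add algebra_simps)

end

definition free_extension_property ::
  "'a topology \<Rightarrow> 'v::real_vector topology \<Rightarrow> ('a \<Rightarrow> 'v) \<Rightarrow> 'e::real_vector topology \<Rightarrow> bool" where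
  "free_extension_property X L i E \<longleftrightarrow>
     (\<forall>f. continuous_map X E f \<longrightarrow>
        (\<exists>!g. g \<in> extensional (topspace L) \<and> linear_map_on (topspace L) g \<and>
              continuous_map L E g \<and> (\<forall>x\<in>topspace X. f x = g (i x))))"

text \<open>
  A definition cannot quantify over all types, so the test spaces \<open>E\<close> range over the locally convex
  spaces carried by subspaces of the free real vector space \<open>'a \<Rightarrow>\<^sub>0 real\<close> on the type of the points
  of \<open>X\<close>. No generality is lost: \<open>free_lcs_universal\<close> below derives the extension property
  for locally convex spaces of arbitrary type, and \<open>free_lcs_exists\<close> shows that \<open>L(X)\<close> exists.
\<close>

definition free_lcs :: "'a topology \<Rightarrow> 'v::real_vector topology \<Rightarrow> ('a \<Rightarrow> 'v) \<Rightarrow> bool" where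
  "free_lcs X L i \<longleftrightarrow>
     locally_convex_space L \<and> continuous_map X L i \<and>
     (\<forall>E :: ('a \<Rightarrow>\<^sub>0 real) topology. locally_convex_space E \<longrightarrow> free_extension_property X L i E)"

lemma linear_map_on_linear: "linear f \<Longrightarrow> linear_map_on V f"
  by (simp add: linear_map_on_def linear_add linear_scale)

lemma linear_map_on_restrict:
  "subspace V \<Longrightarrow> linear_map_on V f \<Longrightarrow> linear_map_on V (restrict f V)"
  by (simp add: linear_map_on_def subspace_add subspace_scale)

lemma linear_map_on_0: "subspace V \<Longrightarrow> linear_map_on V f \<Longrightarrow> f 0 = 0"
  unfolding linear_map_on_def by (metis scale_zero_left subspace_0)

lemma linear_map_on_eq_span:
  assumes V: "subspace V" and g: "linear_map_on V g" and h: "linear_map_on V h"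
    and B: "B \<subseteq> V" and eq: "\<And>x. x \<in> B \<Longrightarrow> g x = h x" and v: "v \<in> span B"
  shows "g v = h v"
proof -
  have "v \<in> V \<and> g v = h v"
    using v
  proof (induction rule: span_induct_alt)
    case base
    show ?case using linear_map_on_0[OF V g] linear_map_on_0[OF V h] V by (simp add: subspace_0)
  next
    case (step c x y)
    have "x \<in> V" "c *\<^sub>R x \<in> V" using B step V by (auto intro: subspace_scale)
    then show ?case using step g h eq[of x] V
      unfolding linear_map_on_def by (auto intro: subspace_add)
  qed
  then show ?thesis by simp
qed

lemma lcs_euclideanreal: "locally_convex_space euclideanreal"
  unfolding locally_convex_space_def
proof (intro conjI)
  show "continuous_map (prod_topology euclideanreal euclideanreal) euclideanreal (\<lambda>(x, y). x + y)"
    by (simp add: case_prod_unfold continuous_map_iff_continuous2 euclidean_product_topology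
        continuous_intros)
  show "continuous_map (prod_topology euclideanreal euclideanreal) euclideanreal (\<lambda>(c, x::real). c *\<^sub>R x)"
    by (simp add: case_prod_unfold continuous_map_iff_continuous2 euclidean_product_topology
        continuous_intros)
  show "neighbourhood_base_at (0::real) convex euclidean"
    unfolding neighbourhood_base_at_def
  proof (intro allI impI)
    fix W :: "real set" assume "openin euclidean W \<and> 0 \<in> W"
    then obtain e where "e > 0" "ball 0 e \<subseteq> W" by (auto simp: open_contains_ball)
    then show "\<exists>U V. openin euclidean U \<and> convex V \<and> 0 \<in> U \<and> U \<subseteq> V \<and> V \<subseteq> W"
      by (intro exI[of _ "ball 0 e"]) auto
  qed
qed auto

lemma lcs_pullback:
  assumes E: "locally_convex_space E" and W: "subspace W" and F: "linear F"
    and FW: "F ` W \<subseteq> topspace E"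
  shows "locally_convex_space (pullback_topology W F E)"
    and "topspace (pullback_topology W F E) = W"
    and "continuous_map (pullback_topology W F E) E F"
proof -
  let ?T = "pullback_topology W F E"
  show top: "topspace ?T = W"
    using FW by (auto simp: topspace_pullback_topology)
  have cF: "continuous_map ?T E F"
    using continuous_map_pullback[OF continuous_map_id, of W F E] by simp
  then show "continuous_map ?T E F" .
  have "continuous_map (prod_topology ?T ?T) E ((\<lambda>(x, y). x + y) \<circ> (\<lambda>(x, y). (F x, F y)))"
    using E cF unfolding locally_convex_space_def
    by (intro continuous_map_compose[where X' = "prod_topology E E"])
      (auto simp: case_prod_unfold intro!: continuous_map_pairedI continuous_map_compose[unfolded o_def, OF continuous_map_fst] continuous_map_compose[unfolded o_def, OF continuous_map_snd])
  moreover have "(\<lambda>(x, y). x + y) \<circ> (\<lambda>(x, y). (F x, F y)) = F \<circ> (\<lambda>(x, y). x + y)"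
    using F by (auto simp: linear_add)
  ultimately have add: "continuous_map (prod_topology ?T ?T) ?T (\<lambda>(x, y). x + y)"
    using W by (intro continuous_map_pullback') (auto simp: top subspace_add)
  have "continuous_map (prod_topology euclideanreal ?T) E ((\<lambda>(x, y). x *\<^sub>R y) \<circ> (\<lambda>(x, y). (x, F y)))"
    using E cF unfolding locally_convex_space_def
    by (intro continuous_map_compose[where X' = "prod_topology euclideanreal E"])
      (auto simp: case_prod_unfold intro!: continuous_map_pairedI continuous_map_fst continuous_map_compose[unfolded o_def, OF continuous_map_snd])
  moreover have "(\<lambda>(x, y). x *\<^sub>R y) \<circ> (\<lambda>(x, y). (x, F y)) = F \<circ> (\<lambda>(x, y). x *\<^sub>R y)"
    using F by (auto simp: linear_scale)
  ultimately have scale: "continuous_map (prod_topology euclideanreal ?T) ?T (\<lambda>(x, y). x *\<^sub>R y)"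
    using W by (intro continuous_map_pullback') (auto simp: top subspace_scale)
  have "neighbourhood_base_at 0 convex ?T"
    unfolding neighbourhood_base_at_def
  proof (intro allI impI)
    fix U assume U: "openin ?T U \<and> 0 \<in> U"
    then obtain O' where O': "openin E O'" "U = F -` O' \<inter> W"
      by (auto simp: openin_pullback_topology)
    then have "0 \<in> O'" using U linear_0[OF F] by auto
    then obtain O1 C where C: "openin E O1" "convex C" "0 \<in> O1" "O1 \<subseteq> C" "C \<subseteq> O'"
      using E O' unfolding locally_convex_space_def neighbourhood_base_at_def by blast
    show "\<exists>O1 C. openin ?T O1 \<and> convex C \<and> 0 \<in> O1 \<and> O1 \<subseteq> C \<and> C \<subseteq> U"
    proof (intro exI conjI)
      show "openin ?T (F -` O1 \<inter> W)" using C by (auto simp: openin_pullback_topology)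
      show "convex (F -` C \<inter> W)"
        using C(2) F W by (simp add: convex_Int convex_linear_vimage subspace_imp_convex)
      show "0 \<in> F -` O1 \<inter> W" using C linear_0[OF F] subspace_0[OF W] by auto
    qed (use C O' in auto)
  qed
  then show "locally_convex_space ?T"
    using W add scale by (simp add: locally_convex_space_def top)
qed

definition lin_ext :: "('a \<Rightarrow> 'e::real_vector) \<Rightarrow> ('a \<Rightarrow>\<^sub>0 real) \<Rightarrow> 'e" where
  "lin_ext f p = (\<Sum>x\<in>Poly_Mapping.keys p. Poly_Mapping.lookup p x *\<^sub>R f x)"

lemma lin_ext_superset:
  "finite K \<Longrightarrow> Poly_Mapping.keys p \<subseteq> K \<Longrightarrow> lin_ext f p = (\<Sum>x\<in>K. Poly_Mapping.lookup p x *\<^sub>R f x)"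
  unfolding lin_ext_def by (rule sum.mono_neutral_left) (auto simp: in_keys_iff)

lemma linear_lin_ext: "linear (lin_ext f)"
proof (rule linearI)
  fix p q :: "'a \<Rightarrow>\<^sub>0 real" and c :: real
  let ?K = "Poly_Mapping.keys p \<union> Poly_Mapping.keys q"
  have "Poly_Mapping.keys (p + q) \<subseteq> ?K" by (rule keys_add)
  then show "lin_ext f (p + q) = lin_ext f p + lin_ext f q"
    by (simp add: lin_ext_superset[of ?K] lookup_add scaleR_left_distrib sum.distrib)
  have "Poly_Mapping.keys (c *\<^sub>R p) \<subseteq> Poly_Mapping.keys p" by (auto simp: in_keys_iff)
  then show "lin_ext f (c *\<^sub>R p) = c *\<^sub>R lin_ext f p"
    by (simp add: lin_ext_superset[of "Poly_Mapping.keys p"] scaleR_sum_right)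
qed

lemma lin_ext_single [simp]: "lin_ext f (Poly_Mapping.single x 1) = f x"
  by (simp add: lin_ext_def)

definition free_carrier :: "'a set \<Rightarrow> ('a \<Rightarrow>\<^sub>0 real) set" where
  "free_carrier S = {p. Poly_Mapping.keys p \<subseteq> S}"

lemma subspace_free_carrier: "subspace (free_carrier S)"
  by (auto simp: subspace_def free_carrier_def subset_iff in_keys_iff lookup_add)
    (metis add_0)

lemma single_in_free_carrier: "x \<in> S \<Longrightarrow> Poly_Mapping.single x 1 \<in> free_carrier S"
  by (simp add: free_carrier_def)

lemma free_carrier_span: "free_carrier S \<subseteq> span ((\<lambda>x. Poly_Mapping.single x 1) ` S)"
proof
  fix p assume p: "p \<in> free_carrier S"
  have "p = lin_ext (\<lambda>x. Poly_Mapping.single x 1) p"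
    by (rule poly_mapping_eqI)
      (auto simp: lin_ext_def lookup_sum lookup_single when_def in_keys_iff if_distrib
        cong: if_cong)
  also have "\<dots> \<in> span ((\<lambda>x. Poly_Mapping.single x 1) ` S)"
    unfolding lin_ext_def using p
    by (intro span_sum span_scale span_base) (auto simp: free_carrier_def)
  finally show "p \<in> span ((\<lambda>x. Poly_Mapping.single x 1) ` S)" .
qed

lemma lin_ext_free_carrier:
  assumes "subspace V" "f ` S \<subseteq> V"
  shows "lin_ext f ` free_carrier S \<subseteq> V"
  using assms unfolding lin_ext_def free_carrier_def
  by (auto intro!: subspace_sum subspace_scale)

lemma lcs_pullback_lin_ext:
  assumes E: "locally_convex_space E" and f: "continuous_map X E f"
  defines "T \<equiv> pullback_topology (free_carrier (topspace X)) (lin_ext f) E"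
  shows "locally_convex_space T" "topspace T = free_carrier (topspace X)"
    "continuous_map T E (lin_ext f)" "continuous_map X T (\<lambda>x. Poly_Mapping.single x 1)"
proof -
  have *: "lin_ext f ` free_carrier (topspace X) \<subseteq> topspace E"
    using E f by (intro lin_ext_free_carrier)
      (auto simp: locally_convex_space_def continuous_map_def)
  show "locally_convex_space T" "topspace T = free_carrier (topspace X)"
    "continuous_map T E (lin_ext f)"
    unfolding T_def using lcs_pullback[OF E subspace_free_carrier linear_lin_ext *] by auto
  show "continuous_map X T (\<lambda>x. Poly_Mapping.single x 1)"
    unfolding T_def
    by (rule continuous_map_pullback') (auto simp: o_def f single_in_free_carrier)
qed

lemma ex1_implies_eq: "\<exists>!x. P x \<Longrightarrow> P a \<Longrightarrow> P b \<Longrightarrow> a = b"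
  by blast

lemma free_lcs_span:
  assumes "free_lcs X L (i :: 'a \<Rightarrow> 'v::real_vector)"
  shows "topspace L = span (i ` topspace X)"
proof
  have L: "locally_convex_space L" "continuous_map X L i" "subspace (topspace L)"
    using assms by (auto simp: free_lcs_def locally_convex_space_def)
  show "span (i ` topspace X) \<subseteq> topspace L"
    using L by (intro span_minimal) (auto simp: continuous_map_def)
  show "topspace L \<subseteq> span (i ` topspace X)"
  proof (rule ccontr)
    assume "\<not> ?thesis"
    then obtain v where v: "v \<in> topspace L" "v \<notin> span (i ` topspace X)" by auto
    obtain B where B: "B \<subseteq> span (i ` topspace X)" "independent B" "span (i ` topspace X) \<subseteq> span B"
      by (meson maximal_independent_subset)
    have sB: "span B = span (i ` topspace X)"
      using B by (meson span_minimal subset_antisym subspace_span)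
    have "independent (insert v B)"
      using B(2) v(2) sB by (auto simp: independent_insert)
    then obtain \<phi> :: "'v \<Rightarrow> real"
      where \<phi>: "linear \<phi>" "\<forall>x\<in>insert v B. \<phi> x = (if x = v then 1 else 0)"
      using linear_independent_extend[of "insert v B" "\<lambda>x. if x = v then 1 else 0"] by blast
    have \<phi>0: "\<phi> x = 0" if "x \<in> span (i ` topspace X)" for x
    proof (rule linear_eq_0_on_span[OF \<phi>(1)])
      show "x \<in> span B" using that sB by simp
      show "\<phi> b = 0" if "b \<in> B" for b
        using \<phi>(2) that B(1) v by auto
    qed
    define E :: "('a \<Rightarrow>\<^sub>0 real) topology" where "E = pullback_topology UNIV (\<lambda>_. 0) euclideanreal"
    have E: "locally_convex_space E"
      unfolding E_def by (rule lcs_pullback(1)[OF lcs_euclideanreal])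
        (auto intro: linear_zero)
    have cX: "continuous_map X E (\<lambda>_. 0)"
      unfolding E_def by (rule continuous_map_pullback') (auto simp: o_def)
    have cL: "continuous_map L E g" for g
      unfolding E_def by (rule continuous_map_pullback') (auto simp: o_def)
    let ?e = "Poly_Mapping.single (undefined :: 'a) (1 :: real)"
    let ?g = "restrict (\<lambda>_. 0 :: 'a \<Rightarrow>\<^sub>0 real) (topspace L)"
    let ?h = "restrict (\<lambda>x. \<phi> x *\<^sub>R ?e) (topspace L)"
    have lin: "linear_map_on (topspace L) ?g" "linear_map_on (topspace L) ?h"
      using L(3) \<phi>(1)
      by (simp_all add: linear_map_on_def linear_add linear_scale scaleR_left_distrib
          subspace_add subspace_scale)
    have ix: "i x \<in> topspace L" "\<phi> (i x) = 0" if "x \<in> topspace X" for x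
      using that L(2) \<phi>0 by (auto simp: continuous_map_def intro: span_base)
    have ex1: "\<exists>!g. g \<in> extensional (topspace L) \<and> linear_map_on (topspace L) g \<and>
        continuous_map L E g \<and> (\<forall>x\<in>topspace X. 0 = g (i x))"
      using assms E cX unfolding free_lcs_def free_extension_property_def by blast
    have "?g = ?h"
    proof (rule ex1_implies_eq[OF ex1])
      show "?g \<in> extensional (topspace L) \<and> linear_map_on (topspace L) ?g \<and>
          continuous_map L E ?g \<and> (\<forall>x\<in>topspace X. 0 = ?g (i x))"
        by (intro conjI lin cL restrict_extensional) (simp add: ix)
      show "?h \<in> extensional (topspace L) \<and> linear_map_on (topspace L) ?h \<and>
          continuous_map L E ?h \<and> (\<forall>x\<in>topspace X. 0 = ?h (i x))"
        by (intro conjI lin cL restrict_extensional) (simp add: ix)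
    qed
    then have "?g v = ?h v" by (rule arg_cong)
    then have "?e = 0" using v(1) \<phi>(2) by simp
    then have "Poly_Mapping.lookup ?e undefined = 0" by (simp only: lookup_zero)
    then show False by simp
  qed
qed

theorem free_lcs_universal:
  fixes E :: "'e::real_vector topology"
  assumes L: "free_lcs X L i" and E: "locally_convex_space E"
  shows "free_extension_property X L i E"
  unfolding free_extension_property_def
proof (intro allI impI)
  fix f assume f: "continuous_map X E f"
  define T where "T = pullback_topology (free_carrier (topspace X)) (lin_ext f) E"
  note T = lcs_pullback_lin_ext[OF E f, folded T_def]
  obtain g where g: "linear_map_on (topspace L) g" "continuous_map L T g"
    "\<forall>x\<in>topspace X. Poly_Mapping.single x 1 = g (i x)"
    using L T(1,4) unfolding free_lcs_def free_extension_property_def by blast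
  have sub: "subspace (topspace L)" and iL: "i ` topspace X \<subseteq> topspace L"
    using L by (auto simp: free_lcs_def locally_convex_space_def continuous_map_def)
  let ?h = "restrict (lin_ext f \<circ> g) (topspace L)"
  have h: "?h \<in> extensional (topspace L) \<and> linear_map_on (topspace L) ?h \<and>
      continuous_map L E ?h \<and> (\<forall>x\<in>topspace X. f x = ?h (i x))"
  proof (intro conjI)
    show "linear_map_on (topspace L) ?h"
      using g(1) linear_lin_ext[of f] by (intro linear_map_on_restrict[OF sub])
        (simp add: linear_map_on_def linear_add linear_scale)
    show "continuous_map L E ?h"
      using continuous_map_compose[OF g(2) T(3)] by (rule continuous_map_eq) simp
    show "\<forall>x\<in>topspace X. f x = ?h (i x)"
      using iL g(3)[rule_format, symmetric] by auto
  qed simp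
  show "\<exists>!g. g \<in> extensional (topspace L) \<and> linear_map_on (topspace L) g \<and>
      continuous_map L E g \<and> (\<forall>x\<in>topspace X. f x = g (i x))"
  proof (rule ex1I[where a = "?h"], rule h)
    fix k assume k: "k \<in> extensional (topspace L) \<and> linear_map_on (topspace L) k \<and>
      continuous_map L E k \<and> (\<forall>x\<in>topspace X. f x = k (i x))"
    show "k = ?h"
    proof (rule extensionalityI[of _ "topspace L"])
      fix v assume "v \<in> topspace L"
      then have v: "v \<in> span (i ` topspace X)" using free_lcs_span[OF L] by simp
      show "k v = ?h v"
      proof (rule linear_map_on_eq_span[OF sub _ _ iL _ v])
        show "k x = ?h x" if x: "x \<in> i ` topspace X" for x
        proof -
          obtain y where y: "y \<in> topspace X" "x = i y" using x by auto
          have "f y = k (i y)" using k[THEN conjunct2, THEN conjunct2, THEN conjunct2] y(1) by (rule bspec)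
          moreover have "f y = ?h (i y)" using h[THEN conjunct2, THEN conjunct2, THEN conjunct2] y(1) by (rule bspec)
          ultimately show ?thesis unfolding y(2) by (rule trans[OF sym])
        qed
        show "linear_map_on (topspace L) k" by (rule k[THEN conjunct2, THEN conjunct1])
        show "linear_map_on (topspace L) ?h" by (rule h[THEN conjunct2, THEN conjunct1])
      qed
    qed (rule k[THEN conjunct1], simp)
  qed
qed

theorem free_lcs_exists:
  fixes X :: "'a topology"
  shows "\<exists>L :: ('a \<Rightarrow>\<^sub>0 real) topology. free_lcs X L (\<lambda>x. Poly_Mapping.single x 1)"
proof -
  let ?W = "free_carrier (topspace X)"
  let ?\<delta> = "\<lambda>x::'a. Poly_Mapping.single x (1::real)"
  define \<C> where "\<C> = {T. locally_convex_space T \<and> topspace T = ?W \<and> continuous_map X T ?\<delta>}"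
  define L where "L = topology_generated_by (\<Union>T\<in>\<C>. {U. openin T U})"
  have ne: "\<exists>T. T \<in> \<C>"
    using lcs_pullback_lin_ext[OF lcs_euclideanreal, of X "\<lambda>_. 0"] unfolding \<C>_def by force
  have topC: "topspace T = ?W" if "T \<in> \<C>" for T
    using that by (simp add: \<C>_def)
  have topL: "topspace L = ?W"
    unfolding L_def topology_generated_by_topspace
    using ne topC by (auto dest!: openin_subset)
  have openL: "openin L U" if "T \<in> \<C>" "openin T U" for T U
    unfolding L_def using that by (intro topology_generated_by_Basis) auto
  have idL: "continuous_map L T id" if "T \<in> \<C>" for T
    unfolding continuous_map_alt
    using that openL topL topC by (auto simp: Int_absorb2 openin_subset)
      (metis Int_absorb2 openin_subset)
  have into: "continuous_map Y L g"
    if "\<And>T. T \<in> \<C> \<Longrightarrow> continuous_map Y T g" for Y :: "'y topology" and g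
    unfolding L_def
  proof (rule continuous_on_generated_topo)
    fix U assume "U \<in> (\<Union>T\<in>\<C>. {U. openin T U})"
    then obtain T where "T \<in> \<C>" "openin T U" by auto
    then have "openin Y {x \<in> topspace Y. g x \<in> U}"
      using that by (auto simp: continuous_map_def)
    then show "openin Y (g -` U \<inter> topspace Y)"
      by (simp add: vimage_def Int_def conj_commute)
  next
    obtain T where "T \<in> \<C>" using ne by auto
    then show "g ` topspace Y \<subseteq> \<Union> (\<Union>T\<in>\<C>. {U. openin T U})"
      using that[of T] by (auto simp: continuous_map_def)
  qed
  have lcsL: "locally_convex_space L"
    unfolding locally_convex_space_def
  proof (intro conjI)
    show "subspace (topspace L)" by (simp add: topL subspace_free_carrier)
    show "continuous_map (prod_topology L L) L (\<lambda>(x, y). x + y)"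
    proof (rule into)
      fix T assume T: "T \<in> \<C>"
      have "continuous_map (prod_topology L L) (prod_topology T T) (\<lambda>z. (id (fst z), id (snd z)))"
        by (intro continuous_map_pairedI continuous_map_compose[unfolded o_def, OF continuous_map_fst idL[OF T]]
            continuous_map_compose[unfolded o_def, OF continuous_map_snd idL[OF T]])
      from continuous_map_compose[OF this, of T "\<lambda>(x, y). x + y"]
      show "continuous_map (prod_topology L L) T (\<lambda>(x, y). x + y)"
        using T by (simp add: \<C>_def locally_convex_space_def o_def case_prod_unfold)
    qed
    show "continuous_map (prod_topology euclideanreal L) L (\<lambda>(x, y). x *\<^sub>R y)"
    proof (rule into)
      fix T assume T: "T \<in> \<C>"
      have "continuous_map (prod_topology euclideanreal L) (prod_topology euclideanreal T) (\<lambda>z. (fst z, id (snd z)))"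
        by (intro continuous_map_pairedI continuous_map_fst
            continuous_map_compose[unfolded o_def, OF continuous_map_snd idL[OF T]])
      from continuous_map_compose[OF this, of T "\<lambda>(x, y). x *\<^sub>R y"]
      show "continuous_map (prod_topology euclideanreal L) T (\<lambda>(x, y). x *\<^sub>R y)"
        using T by (simp add: \<C>_def locally_convex_space_def o_def case_prod_unfold)
    qed
    show "neighbourhood_base_at 0 convex L"
      unfolding neighbourhood_base_at_def
    proof (intro allI impI, elim conjE)
      fix U assume "openin L U" "0 \<in> U"
      then have "generate_topology_on (\<Union>T\<in>\<C>. {U. openin T U}) U" "0 \<in> U"
        unfolding L_def openin_topology_generated_by_iff by auto
      then show "\<exists>O1 C. openin L O1 \<and> convex C \<and> 0 \<in> O1 \<and> O1 \<subseteq> C \<and> C \<subseteq> U"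
      proof (induction rule: generate_topology_on.induct)
        case Empty
        then show ?case by simp
      next
        case (Int a b)
        then obtain O1 C O2 D where
          "openin L O1 \<and> convex C \<and> 0 \<in> O1 \<and> O1 \<subseteq> C \<and> C \<subseteq> a"
          "openin L O2 \<and> convex D \<and> 0 \<in> O2 \<and> O2 \<subseteq> D \<and> D \<subseteq> b" by blast
        then show ?case
          by (intro exI[of _ "O1 \<inter> O2"] exI[of _ "C \<inter> D"]) (auto intro: convex_Int)
      next
        case (UN K)
        then show ?case by (meson UnionE Union_upper subset_trans)
      next
        case (Basis s)
        then obtain T where T: "T \<in> \<C>" "openin T s" by auto
        then have "neighbourhood_base_at 0 convex T"
          by (simp add: \<C>_def locally_convex_space_def)
        then show ?case
          unfolding neighbourhood_base_at_def using T Basis openL by meson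
      qed
    qed
  qed
  have \<delta>L: "continuous_map X L ?\<delta>"
    by (rule into) (simp add: \<C>_def)
  have "free_extension_property X L ?\<delta> E" if E: "locally_convex_space E"
    for E :: "('a \<Rightarrow>\<^sub>0 real) topology"
    unfolding free_extension_property_def
  proof (intro allI impI)
    fix f assume f: "continuous_map X E f"
    define T where "T = pullback_topology ?W (lin_ext f) E"
    note T = lcs_pullback_lin_ext[OF E f, folded T_def]
    have TC: "T \<in> \<C>" using T by (simp add: \<C>_def)
    let ?h = "restrict (lin_ext f) ?W"
    have h: "?h \<in> extensional (topspace L) \<and> linear_map_on (topspace L) ?h \<and>
        continuous_map L E ?h \<and> (\<forall>x\<in>topspace X. f x = ?h (?\<delta> x))"
    proof (intro conjI)
      show "linear_map_on (topspace L) ?h"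
        unfolding topL
        by (intro linear_map_on_restrict subspace_free_carrier linear_map_on_linear linear_lin_ext)
      show "continuous_map L E ?h"
        using continuous_map_compose[OF idL[OF TC] T(3)] by (rule continuous_map_eq) (simp add: topL)
    qed (simp_all add: topL single_in_free_carrier)
    show "\<exists>!g. g \<in> extensional (topspace L) \<and> linear_map_on (topspace L) g \<and>
        continuous_map L E g \<and> (\<forall>x\<in>topspace X. f x = g (?\<delta> x))"
    proof (rule ex1I[where a = "?h"], rule h)
      fix k assume k: "k \<in> extensional (topspace L) \<and> linear_map_on (topspace L) k \<and>
        continuous_map L E k \<and> (\<forall>x\<in>topspace X. f x = k (?\<delta> x))"
      show "k = ?h"
      proof (rule extensionalityI[of _ "topspace L"])
        fix v assume "v \<in> topspace L"
        then have v: "v \<in> span (?\<delta> ` topspace X)" using free_carrier_span topL by blast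
        show "k v = ?h v"
        proof (rule linear_map_on_eq_span[OF _ _ _ _ _ v])
          show "subspace (topspace L)" by (simp add: topL subspace_free_carrier)
          show "?\<delta> ` topspace X \<subseteq> topspace L" by (auto simp: topL single_in_free_carrier)
          show "k x = ?h x" if x: "x \<in> ?\<delta> ` topspace X" for x
          proof -
            obtain y where y: "y \<in> topspace X" "x = ?\<delta> y" using x by auto
            have "f y = k (?\<delta> y)" using k[THEN conjunct2, THEN conjunct2, THEN conjunct2] y(1) by (rule bspec)
            moreover have "f y = ?h (?\<delta> y)" using h[THEN conjunct2, THEN conjunct2, THEN conjunct2] y(1) by (rule bspec)
            ultimately show ?thesis unfolding y(2) by (rule trans[OF sym])
          qed
          show "linear_map_on (topspace L) k" by (rule k[THEN conjunct2, THEN conjunct1])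
          show "linear_map_on (topspace L) ?h" by (rule h[THEN conjunct2, THEN conjunct1])
        qed
      qed (rule k[THEN conjunct1], simp add: topL)
    qed
  qed
  then show ?thesis
    using lcsL \<delta>L unfolding free_lcs_def by blast
qed

end

theory Submission
  imports Defs
begin

text \<open>
  If \<open>X\<close> is discrete, \<open>L(X)\<close> carries the finest locally convex topology, and a set of functionals that
  is bounded at each point is equicontinuous. If the group topology \<open>N\<close> has the same characters as
  \<open>L(X)\<close> and \<open>A\<close> is a quasi-convex \<open>N\<close>-neighbourhood of \<open>0\<close>, the functionals \<open>f\<close> with \<open>cos f \<ge> 0\<close> on \<open>A\<close>
  are bounded at each point, and hence \<open>A\<close> is a neighbourhood of \<open>0\<close> in \<open>L(X)\<close>.

  If \<open>X\<close> has a nonisolated point \<open>x0\<close>, there is a point-finite, uniformly bounded family of continuous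
  functions that is not equicontinuous at \<open>x0\<close>. Joining the topology of \<open>L(X)\<close> with that of uniform
  convergence on this family gives a strictly finer locally convex topology. By a gliding hump argument
  it has no new continuous functionals, and hence no new characters, since a continuous character of a
  locally convex space is \<open>cis \<circ> f\<close> for a continuous functional \<open>f\<close>. It is locally quasi-convex if \<open>L(X)\<close> is.
\<close>

section \<open>Topological groups and locally convex spaces\<close>

text \<open>A group topology \<open>N\<close> compatible with \<open>L\<close> need not be a vector
  topology: its neighbourhoods of \<open>0\<close> cannot be scaled, only pulled back along the
  doubling \<open>v + v\<close>. Doubling still suffices to make a homomorphism into the circle
  continuous for \<open>N\<close> once its real part is nonnegative on some
  \<open>N\<close>-neighbourhood of \<open>0\<close>. So compactness of a product of circles can
  produce characters of \<open>N\<close>, and compatibility turns them into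
  \<open>cis \<circ> f\<close>, which is close to \<open>1\<close> at all short multiples of a
  vector. Point-finiteness matters because \<open>X\<close> spans \<open>L(X)\<close>: each vector
  is seen by only finitely many of the functionals, which keeps successive humps apart. The uniform
  bound matters because continuity of a functional is tested on \<open>X\<close> alone: differences
  of points of \<open>X\<close> are then bounded vectors for the new seminorm. Local quasi-convexity
  of \<open>L(X)\<close> is obtained from polars of weighted families of functionals if
  \<open>X\<close> is discrete; otherwise it is part of the assumption to be refuted.\<close>

lemma abelian_topological_group_closed:
  assumes "abelian_topological_group T"
  shows "0 \<in> topspace T"
    and "x \<in> topspace T \<Longrightarrow> y \<in> topspace T \<Longrightarrow> x + y \<in> topspace T"
    and "x \<in> topspace T \<Longrightarrow> - x \<in> topspace T"
    and "x \<in> topspace T \<Longrightarrow> y \<in> topspace T \<Longrightarrow> x - y \<in> topspace T"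
proof -
  have a: "continuous_map (prod_topology T T) T (\<lambda>(x, y). x + y)" and m: "continuous_map T T uminus"
    using assms by (auto simp: abelian_topological_group_def)
  show "0 \<in> topspace T" using assms by (auto simp: abelian_topological_group_def)
  show add: "x + y \<in> topspace T" if "x \<in> topspace T" "y \<in> topspace T" for x y
    using continuous_map_image_subset_topspace[OF a] that by fastforce
  show neg: "- x \<in> topspace T" if "x \<in> topspace T" for x
    using continuous_map_image_subset_topspace[OF m] that by fastforce
  show "x - y \<in> topspace T" if "x \<in> topspace T" "y \<in> topspace T"
    using add[OF that(1) neg[OF that(2)]] by simp
qed

lemma continuous_map_add:
  assumes "abelian_topological_group T" "continuous_map Y T f" "continuous_map Y T g"
  shows "continuous_map Y T (\<lambda>y. f y + g y)"
proof -
  have "continuous_map (prod_topology T T) T (\<lambda>(x, y). x + y)"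
    using assms(1) by (auto simp: abelian_topological_group_def)
  from continuous_map_compose[OF continuous_map_pairedI[OF assms(2,3)] this]
  show ?thesis by (simp add: o_def)
qed

lemma openin_translate:
  assumes "abelian_topological_group T" "openin T U" "a \<in> topspace T"
  shows "openin T {v \<in> topspace T. a + v \<in> U}"
proof -
  have "continuous_map T T (\<lambda>v. a + v)"
    using assms by (intro continuous_map_add) (auto simp: continuous_map_const)
  then show ?thesis using assms(2) by (rule openin_continuous_map_preimage)
qed

text \<open>Translations are homeomorphisms for both topologies, so neighbourhoods of
  \<open>0\<close> decide the comparison.\<close>

lemma finer_thanI_zero:
  assumes T: "abelian_topological_group T" and N: "abelian_topological_group N"
    and top: "topspace N = topspace T"
    and nb: "\<And>U. openin N U \<Longrightarrow> 0 \<in> U \<Longrightarrow> \<exists>W. openin T W \<and> 0 \<in> W \<and> W \<subseteq> U"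
  shows "finer_than T N"
  unfolding finer_than_def
proof (intro allI impI)
  fix U assume U: "openin N U"
  show "openin T U"
  proof (subst openin_subopen, intro ballI)
    fix x assume x: "x \<in> U"
    then have xT: "x \<in> topspace T" using openin_subset[OF U] top by auto
    have "openin N {v \<in> topspace N. x + v \<in> U}" "0 \<in> {v \<in> topspace N. x + v \<in> U}"
      using openin_translate[OF N U] x xT top abelian_topological_group_closed(1)[OF N] by auto
    then obtain W where W: "openin T W" "0 \<in> W" "W \<subseteq> {v \<in> topspace N. x + v \<in> U}"
      using nb by blast
    have "openin T {v \<in> topspace T. - x + v \<in> W}"
      by (rule openin_translate[OF T W(1)]) (rule abelian_topological_group_closed(3)[OF T xT])
    moreover have "v \<in> U" if "- x + v \<in> W" for v
      using subsetD[OF W(3) that] by simp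
    ultimately show "\<exists>W. openin T W \<and> x \<in> W \<and> W \<subseteq> U"
      using W(2) xT by (intro exI[of _ "{v \<in> topspace T. - x + v \<in> W}"]) auto
  qed
qed

text \<open>Uniform control of increments is asked for, and \<open>h\<close> need not be additive:
  this serves real functionals and circle-valued homomorphisms alike.\<close>

lemma continuous_mapI_translate:
  fixes h :: "'g::ab_group_add \<Rightarrow> 'b::metric_space"
  assumes T: "abelian_topological_group T"
    and h: "\<And>e. e > 0 \<Longrightarrow> \<exists>W. openin T W \<and> 0 \<in> W \<and>
          (\<forall>x\<in>topspace T. \<forall>v\<in>W. dist (h (x + v)) (h x) < e)"
  shows "continuous_map T euclidean h"
  unfolding continuous_map_def
proof (intro conjI allI impI)
  fix S :: "'b set" assume "openin euclidean S"
  then have S: "open S" by simp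
  show "openin T {x \<in> topspace T. h x \<in> S}"
  proof (subst openin_subopen, intro ballI)
    fix x assume x: "x \<in> {x \<in> topspace T. h x \<in> S}"
    then obtain e where e: "e > 0" "ball (h x) e \<subseteq> S" using S open_contains_ball by blast
    obtain W where W: "openin T W" "0 \<in> W" "\<forall>x\<in>topspace T. \<forall>v\<in>W. dist (h (x + v)) (h x) < e"
      using h[OF e(1)] by blast
    have "openin T {v \<in> topspace T. - x + v \<in> W}"
      using x by (intro openin_translate[OF T W(1)]) (auto intro: abelian_topological_group_closed(3)[OF T])
    moreover have "h v \<in> S" if "- x + v \<in> W" for v
    proof -
      have "dist (h (x + (- x + v))) (h x) < e" using W(3) x that by blast
      then show ?thesis using e(2) by (auto simp: dist_commute)
    qed
    ultimately show "\<exists>W. openin T W \<and> x \<in> W \<and> W \<subseteq> {x \<in> topspace T. h x \<in> S}"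
      using W(2) x by (intro exI[of _ "{v \<in> topspace T. - x + v \<in> W}"]) auto
  qed
qed auto

section \<open>Continuous functionals on locally convex spaces\<close>

lemma lcs_subspace: "locally_convex_space T \<Longrightarrow> subspace (topspace T)"
  by (simp add: locally_convex_space_def)

lemma continuous_map_scaleR:
  assumes "locally_convex_space T" "continuous_map Y euclideanreal c" "continuous_map Y T g"
  shows "continuous_map Y T (\<lambda>y. c y *\<^sub>R g y)"
proof -
  have "continuous_map (prod_topology euclideanreal T) T (\<lambda>(c, x). c *\<^sub>R x)"
    using assms(1) by (auto simp: locally_convex_space_def)
  from continuous_map_compose[OF continuous_map_pairedI[OF assms(2,3)] this]
  show ?thesis by (simp add: o_def)
qed

lemma lcs_abelian_topological_group:
  assumes "locally_convex_space T"
  shows "abelian_topological_group T"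
  unfolding abelian_topological_group_def
proof (intro conjI)
  show "0 \<in> topspace T" using lcs_subspace[OF assms] by (rule subspace_0)
  show "continuous_map (prod_topology T T) T (\<lambda>(x, y). x + y)"
    using assms by (simp add: locally_convex_space_def)
  show "continuous_map T T uminus"
    using continuous_map_scaleR[OF assms, of T "\<lambda>_. -1" "\<lambda>x. x"] by simp
qed

lemma openin_scaleR:
  assumes "locally_convex_space T" "openin T U"
  shows "openin T {v \<in> topspace T. c *\<^sub>R v \<in> U}"
proof -
  have "continuous_map T T (\<lambda>v. c *\<^sub>R v)"
    using continuous_map_scaleR[OF assms(1), of T "\<lambda>_. c" "\<lambda>v. v"] by simp
  then show ?thesis using assms(2) by (rule openin_continuous_map_preimage)
qed

lemma linear_map_on_add:
  "linear_map_on V f \<Longrightarrow> x \<in> V \<Longrightarrow> y \<in> V \<Longrightarrow> f (x + y) = f x + f y"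
  by (simp add: linear_map_on_def)

lemma linear_map_on_scale: "linear_map_on V f \<Longrightarrow> x \<in> V \<Longrightarrow> f (c *\<^sub>R x) = c *\<^sub>R f x"
  by (simp add: linear_map_on_def)

lemma linear_map_on_diff:
  assumes "linear_map_on V f" "subspace V" "x \<in> V" "y \<in> V"
  shows "f (x - y) = f x - f y"
  using linear_map_on_add[OF assms(1), of "x - y" y] assms by (simp add: subspace_diff)

text \<open>The members of \<open>topological_dual\<close> with extensionality dropped, so that
  functionals can be scaled and extended without \<open>restrict\<close>.\<close>

definition cont_linear :: "'v::real_vector topology \<Rightarrow> ('v \<Rightarrow> real) \<Rightarrow> bool" where
  "cont_linear T f \<longleftrightarrow> linear_map_on (topspace T) f \<and> continuous_map T euclideanreal f"

lemma cont_linearI_bounded: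
  assumes T: "locally_convex_space T" and f: "linear_map_on (topspace T) f"
    and W: "openin T W" "0 \<in> W" and M: "\<And>v. v \<in> W \<Longrightarrow> \<bar>f v\<bar> \<le> M"
  shows "cont_linear T f"
  unfolding cont_linear_def
proof
  show "continuous_map T euclideanreal f"
  proof (rule continuous_mapI_translate[OF lcs_abelian_topological_group[OF T]])
    fix e :: real assume e: "e > 0"
    define c where "c = (\<bar>M\<bar> + 1) / e"
    have c: "c > 0" using e by (simp add: c_def field_simps)
    let ?W = "{v \<in> topspace T. c *\<^sub>R v \<in> W}"
    have "\<bar>f v\<bar> < e" if "v \<in> ?W" for v
    proof -
      have "\<bar>f (c *\<^sub>R v)\<bar> \<le> M" using that M by auto
      then have "c * \<bar>f v\<bar> \<le> M" using linear_map_on_scale[OF f, of v c] that c by (simp add: abs_mult)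
      also have "\<dots> < c * e" using e by (simp add: c_def)
      finally show ?thesis using c by simp
    qed
    then have "\<forall>x\<in>topspace T. \<forall>v\<in>?W. dist (f (x + v)) (f x) < e"
      using linear_map_on_add[OF f] by (auto simp: dist_real_def)
    then show "\<exists>W. openin T W \<and> 0 \<in> W \<and> (\<forall>x\<in>topspace T. \<forall>v\<in>W. dist (f (x + v)) (f x) < e)"
      using openin_scaleR[OF T W(1), of c] W(2) openin_subset[OF W(1)]
      by (intro exI[of _ ?W]) auto
  qed
qed (rule f)

lemma cont_linear_small:
  assumes "cont_linear T f" "locally_convex_space T" "e > 0"
  shows "openin T {v \<in> topspace T. \<bar>f v\<bar> < e}" "0 \<in> {v \<in> topspace T. \<bar>f v\<bar> < e}"
proof -
  have "openin T {v \<in> topspace T. f v \<in> ball 0 e}"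
    using assms(1) by (intro openin_continuous_map_preimage[where Y = euclideanreal])
      (auto simp: cont_linear_def)
  then show "openin T {v \<in> topspace T. \<bar>f v\<bar> < e}" by (simp add: dist_real_def)
  show "0 \<in> {v \<in> topspace T. \<bar>f v\<bar> < e}"
    using assms linear_map_on_0[OF lcs_subspace[OF assms(2)], of f] subspace_0[OF lcs_subspace[OF assms(2)]]
    by (simp add: cont_linear_def)
qed

section \<open>Refining a locally convex topology\<close>

definition pointwise_bounded :: "'v set \<Rightarrow> ('v \<Rightarrow> real) set \<Rightarrow> bool" where
  "pointwise_bounded V \<Phi> \<longleftrightarrow> (\<forall>v\<in>V. \<exists>M. \<forall>f\<in>\<Phi>. \<bar>f v\<bar> \<le> M)"

text \<open>The join of \<open>T\<close> with the topology of the seminorm \<open>v \<mapsto> sup {|f v| | f \<in> \<Phi>}\<close>,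
  provided the functionals in \<open>\<Phi>\<close> are linear and bounded at each point.\<close>

definition refine :: "'v::real_vector topology \<Rightarrow> ('v \<Rightarrow> real) set \<Rightarrow> 'v topology" where
  "refine T \<Phi> = topology (\<lambda>U. U \<subseteq> topspace T \<and>
     (\<forall>x\<in>U. \<exists>W e. openin T W \<and> x \<in> W \<and> e > 0 \<and> {y \<in> W. \<forall>f\<in>\<Phi>. \<bar>f (y - x)\<bar> \<le> e} \<subseteq> U))"

lemma openin_refine:
  "openin (refine T \<Phi>) U \<longleftrightarrow> U \<subseteq> topspace T \<and>
     (\<forall>x\<in>U. \<exists>W e. openin T W \<and> x \<in> W \<and> e > 0 \<and> {y \<in> W. \<forall>f\<in>\<Phi>. \<bar>f (y - x)\<bar> \<le> e} \<subseteq> U)"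
proof -
  have "istopology (\<lambda>U. U \<subseteq> topspace T \<and>
     (\<forall>x\<in>U. \<exists>W e. openin T W \<and> x \<in> W \<and> e > 0 \<and> {y \<in> W. \<forall>f\<in>\<Phi>. \<bar>f (y - x)\<bar> \<le> e} \<subseteq> U))"
    (is "istopology ?P")
    unfolding istopology_def
  proof (rule conjI; intro allI impI)
    fix S S' assume S: "?P S" and S': "?P S'"
    show "?P (S \<inter> S')"
    proof (intro conjI ballI)
      fix x assume "x \<in> S \<inter> S'"
      then obtain W e W' e' where
        "openin T W" "x \<in> W" "e > 0" "{y \<in> W. \<forall>f\<in>\<Phi>. \<bar>f (y - x)\<bar> \<le> e} \<subseteq> S"
        "openin T W'" "x \<in> W'" "e' > 0" "{y \<in> W'. \<forall>f\<in>\<Phi>. \<bar>f (y - x)\<bar> \<le> e'} \<subseteq> S'"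
        using S S' by (meson IntE)
      then show "\<exists>W e. openin T W \<and> x \<in> W \<and> e > 0 \<and> {y \<in> W. \<forall>f\<in>\<Phi>. \<bar>f (y - x)\<bar> \<le> e} \<subseteq> S \<inter> S'"
        by (intro exI[of _ "W \<inter> W'"] exI[of _ "min e e'"]) auto
    qed (use S in auto)
  next
    fix \<K> assume K: "\<forall>K\<in>\<K>. ?P K"
    show "?P (\<Union>\<K>)"
    proof (intro conjI ballI)
      fix x assume "x \<in> \<Union>\<K>"
      then obtain K where "K \<in> \<K>" "x \<in> K" by auto
      moreover then obtain W e where
        "openin T W" "x \<in> W" "e > 0" "{y \<in> W. \<forall>f\<in>\<Phi>. \<bar>f (y - x)\<bar> \<le> e} \<subseteq> K"
        using K by meson
      ultimately show "\<exists>W e. openin T W \<and> x \<in> W \<and> e > 0 \<and> {y \<in> W. \<forall>f\<in>\<Phi>. \<bar>f (y - x)\<bar> \<le> e} \<subseteq> \<Union>\<K>"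
        by (intro exI[of _ W] exI[of _ e]) auto
    qed (use K in auto)
  qed
  then show ?thesis unfolding refine_def by simp
qed

lemma openin_refineI: "openin T U \<Longrightarrow> openin (refine T \<Phi>) U"
  unfolding openin_refine using openin_subset[of T U]
  by (auto intro!: exI[of _ U] exI[of _ "1::real"])

lemma topspace_refine [simp]: "topspace (refine T \<Phi>) = topspace T"
proof
  show "topspace (refine T \<Phi>) \<subseteq> topspace T"
    using openin_topspace[of "refine T \<Phi>"] unfolding openin_refine by blast
  show "topspace T \<subseteq> topspace (refine T \<Phi>)"
    by (intro openin_subset openin_refineI openin_topspace)
qed

text \<open>The bound \<open>d < e\<close> says that the supremum over \<open>\<Phi>\<close> is
  below \<open>e\<close> without forming a supremum. The gap \<open>e - d\<close> is the room that
  makes the set open; the set given by \<open>\<bar>f (y - x)\<bar> < e\<close> for each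
  \<open>f\<close> separately would leave no such room.\<close>

lemma openin_refine_small:
  assumes V: "subspace (topspace T)" and \<Phi>: "\<And>f. f \<in> \<Phi> \<Longrightarrow> linear_map_on (topspace T) f"
    and x: "x \<in> topspace T"
  shows "openin (refine T \<Phi>) {y \<in> topspace T. \<exists>d<e. \<forall>f\<in>\<Phi>. \<bar>f (y - x)\<bar> \<le> d}"
  unfolding openin_refine
proof (intro conjI ballI)
  fix y assume "y \<in> {y \<in> topspace T. \<exists>d<e. \<forall>f\<in>\<Phi>. \<bar>f (y - x)\<bar> \<le> d}"
  then obtain d where y: "y \<in> topspace T" "d < e" "\<forall>f\<in>\<Phi>. \<bar>f (y - x)\<bar> \<le> d" by auto
  have "\<exists>d<e. \<forall>f\<in>\<Phi>. \<bar>f (z - x)\<bar> \<le> d"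
    if z: "z \<in> topspace T" "\<forall>f\<in>\<Phi>. \<bar>f (z - y)\<bar> \<le> (e - d) / 2" for z
  proof (intro exI conjI ballI)
    show "d + (e - d) / 2 < e" using y(2) by (simp add: field_simps)
    fix f assume f: "f \<in> \<Phi>"
    have "f (z - x) = f (y - x) + f (z - y)"
      using linear_map_on_diff[OF \<Phi>[OF f] V] x y z by simp
    then show "\<bar>f (z - x)\<bar> \<le> d + (e - d) / 2" using bspec[OF y(3) f] bspec[OF z(2) f] by linarith
  qed
  then show "\<exists>W e'. openin T W \<and> y \<in> W \<and> e' > 0 \<and> {z \<in> W. \<forall>f\<in>\<Phi>. \<bar>f (z - y)\<bar> \<le> e'}
      \<subseteq> {y \<in> topspace T. \<exists>d<e. \<forall>f\<in>\<Phi>. \<bar>f (y - x)\<bar> \<le> d}"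
    using y by (intro exI[of _ "topspace T"] exI[of _ "(e - d) / 2"]) auto
qed auto

text \<open>Since \<open>refine T \<Phi>\<close> is a join, continuity into it splits into
  continuity into \<open>T\<close> and smallness uniformly over \<open>\<Phi>\<close>.\<close>

lemma continuous_map_into_refine:
  assumes g: "continuous_map Y T g"
    and small: "\<And>y e. y \<in> topspace Y \<Longrightarrow> e > 0 \<Longrightarrow>
      \<exists>W. openin Y W \<and> y \<in> W \<and> (\<forall>z\<in>W. \<forall>f\<in>\<Phi>. \<bar>f (g z - g y)\<bar> \<le> e)"
  shows "continuous_map Y (refine T \<Phi>) g"
  unfolding continuous_map_def
proof (intro conjI allI impI)
  show "g \<in> topspace Y \<rightarrow> topspace (refine T \<Phi>)"
    using g by (simp add: continuous_map_def)
  fix U assume U: "openin (refine T \<Phi>) U"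
  show "openin Y {y \<in> topspace Y. g y \<in> U}"
  proof (subst openin_subopen, intro ballI)
    fix y assume y: "y \<in> {y \<in> topspace Y. g y \<in> U}"
    then obtain O' e where O': "openin T O'" "g y \<in> O'" "e > 0"
      "{z \<in> O'. \<forall>f\<in>\<Phi>. \<bar>f (z - g y)\<bar> \<le> e} \<subseteq> U"
      using U unfolding openin_refine by blast
    obtain W where W: "openin Y W" "y \<in> W" "\<forall>z\<in>W. \<forall>f\<in>\<Phi>. \<bar>f (g z - g y)\<bar> \<le> e"
      using small[of y e] y O' by blast
    have "openin Y (W \<inter> {y \<in> topspace Y. g y \<in> O'})"
      by (intro openin_Int W(1) openin_continuous_map_preimage[OF g O'(1)])
    then show "\<exists>W. openin Y W \<and> y \<in> W \<and> W \<subseteq> {y \<in> topspace Y. g y \<in> U}"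
      using W O' y by (intro exI[of _ "W \<inter> {y \<in> topspace Y. g y \<in> O'}"]) auto
  qed
qed

lemma lcs_refine:
  assumes T: "locally_convex_space T" and \<Phi>: "\<And>f. f \<in> \<Phi> \<Longrightarrow> linear_map_on (topspace T) f"
    and bd: "pointwise_bounded (topspace T) \<Phi>"
  shows "locally_convex_space (refine T \<Phi>)"
proof -
  let ?R = "refine T \<Phi>" and ?V = "topspace T"
  note V = lcs_subspace[OF T]
  have id: "continuous_map ?R T (\<lambda>x. x)"
  proof -
    have "{x \<in> ?V. x \<in> U} = U" if "openin T U" for U using openin_subset[OF that] by auto
    then show ?thesis by (simp add: continuous_map_def openin_refineI)
  qed
  define B where "B x e = {y \<in> ?V. \<exists>d<e. \<forall>f\<in>\<Phi>. \<bar>f (y - x)\<bar> \<le> d}" for x :: 'a and e :: real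
  have B: "openin ?R (B x e)" if "x \<in> ?V" for x e
    unfolding B_def using openin_refine_small[OF V \<Phi> that] by blast
  have xB: "x \<in> B x e" if "x \<in> ?V" "e > 0" for x e
  proof -
    have "\<forall>f\<in>\<Phi>. \<bar>f (x - x)\<bar> \<le> 0" using linear_map_on_0[OF V \<Phi>] by simp
    then show ?thesis using that unfolding B_def by blast
  qed
  have Bd: "y \<in> ?V" "f \<in> \<Phi> \<Longrightarrow> \<bar>f (y - x)\<bar> \<le> e" if "y \<in> B x e" for x y e f
    using that unfolding B_def by force+
  have add: "continuous_map (prod_topology ?R ?R) ?R (\<lambda>(x, y). x + y)"
  proof (rule continuous_map_into_refine)
    show "continuous_map (prod_topology ?R ?R) T (\<lambda>(x, y). x + y)"
      unfolding case_prod_unfold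
      by (intro continuous_map_add lcs_abelian_topological_group T
          continuous_map_compose[unfolded o_def, OF continuous_map_fst id]
          continuous_map_compose[unfolded o_def, OF continuous_map_snd id])
    fix y :: "'a \<times> 'a" and e :: real assume y: "y \<in> topspace (prod_topology ?R ?R)" and e: "e > 0"
    obtain a b where ab: "y = (a, b)" by (cases y)
    then have abV: "a \<in> ?V" "b \<in> ?V" using y by auto
    show "\<exists>W. openin (prod_topology ?R ?R) W \<and> y \<in> W \<and>
        (\<forall>z\<in>W. \<forall>f\<in>\<Phi>. \<bar>f ((case z of (x, y) \<Rightarrow> x + y) - (case y of (x, y) \<Rightarrow> x + y))\<bar> \<le> e)"
    proof (intro exI conjI ballI)
      show "openin (prod_topology ?R ?R) (B a (e/2) \<times> B b (e/2))"
        using B abV by (simp add: openin_prod_Times_iff)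
      show "y \<in> B a (e/2) \<times> B b (e/2)" using xB abV e ab by auto
      fix z f assume z: "z \<in> B a (e/2) \<times> B b (e/2)" and f: "f \<in> \<Phi>"
      obtain c d where cd: "z = (c, d)" by (cases z)
      have "c \<in> B a (e/2)" "d \<in> B b (e/2)" using z cd by auto
      note cd' = Bd[OF this(1)] Bd[OF this(2)]
      have "f ((c - a) + (d - b)) = f (c - a) + f (d - b)"
        using cd'(1,3) abV V by (intro linear_map_on_add[OF \<Phi>[OF f]]) (auto intro: subspace_diff)
      moreover have "(c - a) + (d - b) = c + d - (a + b)" by simp
      ultimately have "f (c + d - (a + b)) = f (c - a) + f (d - b)" by (simp only:)
      then show "\<bar>f ((case z of (x, y) \<Rightarrow> x + y) - (case y of (x, y) \<Rightarrow> x + y))\<bar> \<le> e"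
        using cd'(2)[OF f] cd'(4)[OF f] by (simp add: ab cd)
    qed
  qed
  have scale: "continuous_map (prod_topology euclideanreal ?R) ?R (\<lambda>(x, y). x *\<^sub>R y)"
  proof (rule continuous_map_into_refine)
    show "continuous_map (prod_topology euclideanreal ?R) T (\<lambda>(x, y). x *\<^sub>R y)"
      unfolding case_prod_unfold
      by (intro continuous_map_scaleR T continuous_map_fst
          continuous_map_compose[unfolded o_def, OF continuous_map_snd id])
    fix y :: "real \<times> 'a" and e :: real
    assume y: "y \<in> topspace (prod_topology euclideanreal ?R)" and e: "e > 0"
    obtain a b where ab: "y = (a, b)" by (cases y)
    then have bV: "b \<in> ?V" using y by auto
    obtain M where M: "\<And>f. f \<in> \<Phi> \<Longrightarrow> \<bar>f b\<bar> \<le> M" using bd bV unfolding pointwise_bounded_def by blast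
    \<comment> \<open>The difference of products is split as
      \<open>c *\<^sub>R (d - b) + (c - a) *\<^sub>R b\<close>, and each summand gets
      \<open>e / 2\<close>. The cap \<open>1\<close> gives
      \<open>\<bar>c\<bar> \<le> \<bar>a\<bar> + 1\<close>. The bound \<open>M\<close> at the fixed
      vector \<open>b\<close> is where pointwise boundedness makes the scalar multiplication
      continuous.\<close>
    define \<delta> where "\<delta> = min 1 (e / (2 * (\<bar>M\<bar> + 1)))"
    define \<eta> where "\<eta> = e / (2 * (\<bar>a\<bar> + 1))"
    have \<delta>: "\<delta> > 0" "\<delta> \<le> 1" and \<eta>: "\<eta> > 0" using e by (auto simp: \<delta>_def \<eta>_def)
    show "\<exists>W. openin (prod_topology euclideanreal ?R) W \<and> y \<in> W \<and>
        (\<forall>z\<in>W. \<forall>f\<in>\<Phi>. \<bar>f ((case z of (x, y) \<Rightarrow> x *\<^sub>R y) - (case y of (x, y) \<Rightarrow> x *\<^sub>R y))\<bar> \<le> e)"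
    proof (intro exI conjI ballI)
      show "openin (prod_topology euclideanreal ?R) (ball a \<delta> \<times> B b \<eta>)"
        using B bV by (simp add: openin_prod_Times_iff)
      show "y \<in> ball a \<delta> \<times> B b \<eta>" using xB bV \<delta> \<eta> ab by auto
      fix z f assume z: "z \<in> ball a \<delta> \<times> B b \<eta>" and f: "f \<in> \<Phi>"
      obtain c d where cd: "z = (c, d)" by (cases z)
      have c: "\<bar>c - a\<bar> < \<delta>" and "d \<in> B b \<eta>" using z cd by (auto simp: dist_real_def)
      note d = Bd[OF this(2)]
      have dV: "d - b \<in> ?V" "c *\<^sub>R (d - b) \<in> ?V" "(c - a) *\<^sub>R b \<in> ?V"
        using d(1) bV V by (auto intro: subspace_diff subspace_scale)
      have "c *\<^sub>R d - a *\<^sub>R b = c *\<^sub>R (d - b) + (c - a) *\<^sub>R b" by (simp add: algebra_simps)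
      then have "f (c *\<^sub>R d - a *\<^sub>R b) = c * f (d - b) + (c - a) * f b"
        using linear_map_on_add[OF \<Phi>[OF f] dV(2,3)] linear_map_on_scale[OF \<Phi>[OF f] dV(1)]
          linear_map_on_scale[OF \<Phi>[OF f] bV] by simp
      moreover have "\<bar>c * f (d - b)\<bar> \<le> (\<bar>a\<bar> + 1) * \<eta>"
        unfolding abs_mult using c \<delta> d(2)[OF f] by (intro mult_mono) auto
      moreover have "(\<bar>a\<bar> + 1) * \<eta> = e / 2" by (simp add: \<eta>_def field_simps)
      moreover have "\<bar>(c - a) * f b\<bar> \<le> e / (2 * (\<bar>M\<bar> + 1)) * (\<bar>M\<bar> + 1)"
        unfolding abs_mult using c M[OF f] e by (intro mult_mono) (auto simp: \<delta>_def)
      moreover have "e / (2 * (\<bar>M\<bar> + 1)) * (\<bar>M\<bar> + 1) = e / 2" by (simp add: field_simps)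
      ultimately have "\<bar>f (c *\<^sub>R d - a *\<^sub>R b)\<bar> \<le> e" by linarith
      then show "\<bar>f ((case z of (x, y) \<Rightarrow> x *\<^sub>R y) - (case y of (x, y) \<Rightarrow> x *\<^sub>R y))\<bar> \<le> e"
        by (simp add: ab cd)
    qed
  qed
  have "neighbourhood_base_at 0 convex ?R"
    unfolding neighbourhood_base_at_def
  proof (intro allI impI)
    fix U assume U: "openin ?R U \<and> 0 \<in> U"
    then obtain O' e where O': "openin T O'" "0 \<in> O'" "e > 0" "{y \<in> O'. \<forall>f\<in>\<Phi>. \<bar>f (y - 0)\<bar> \<le> e} \<subseteq> U"
      unfolding openin_refine by blast
    then obtain W C where C: "openin T W" "convex C" "0 \<in> W" "W \<subseteq> C" "C \<subseteq> O'"
      using T unfolding locally_convex_space_def neighbourhood_base_at_def by blast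
    have CV: "C \<subseteq> ?V" using C O' openin_subset by blast
    have 0: "0 \<in> ?V" using V by (rule subspace_0)
    show "\<exists>O1 D. openin ?R O1 \<and> convex D \<and> 0 \<in> O1 \<and> O1 \<subseteq> D \<and> D \<subseteq> U"
    proof (intro exI conjI)
      show "openin ?R (W \<inter> B 0 e)" using openin_refineI[OF C(1)] B[OF 0] by (rule openin_Int)
      show "convex {y \<in> C. \<forall>f\<in>\<Phi>. \<bar>f y\<bar> \<le> e}"
        unfolding convex_def
      proof (intro ballI allI impI CollectI conjI)
        fix x y and u v :: real
        assume x: "x \<in> {y \<in> C. \<forall>f\<in>\<Phi>. \<bar>f y\<bar> \<le> e}" and y: "y \<in> {y \<in> C. \<forall>f\<in>\<Phi>. \<bar>f y\<bar> \<le> e}"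
          and uv: "0 \<le> u" "0 \<le> v" "u + v = 1"
        show "u *\<^sub>R x + v *\<^sub>R y \<in> C" using x y uv C(2) by (auto intro: convexD)
        fix f assume f: "f \<in> \<Phi>"
        have xy: "x \<in> ?V" "y \<in> ?V" using x y CV by auto
        have "f (u *\<^sub>R x + v *\<^sub>R y) = u * f x + v * f y"
          using linear_map_on_add[OF \<Phi>[OF f], of "u *\<^sub>R x" "v *\<^sub>R y"] linear_map_on_scale[OF \<Phi>[OF f]]
            xy V by (simp add: subspace_scale)
        also have "\<bar>\<dots>\<bar> \<le> u * \<bar>f x\<bar> + v * \<bar>f y\<bar>"
          using uv abs_triangle_ineq[of "u * f x" "v * f y"] by (simp add: abs_mult)
        also have "\<dots> \<le> u * e + v * e"
          using x y uv f by (intro add_mono mult_left_mono) auto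
        also have "\<dots> = e" using uv by (simp flip: distrib_right)
        finally show "\<bar>f (u *\<^sub>R x + v *\<^sub>R y)\<bar> \<le> e" .
      qed
      show "0 \<in> W \<inter> B 0 e" using C xB[OF 0] O' by simp
      show "W \<inter> B 0 e \<subseteq> {y \<in> C. \<forall>f\<in>\<Phi>. \<bar>f y\<bar> \<le> e}" using C Bd[of _ 0 e] by auto
      show "{y \<in> C. \<forall>f\<in>\<Phi>. \<bar>f y\<bar> \<le> e} \<subseteq> U" using C O' by auto
    qed
  qed
  then show ?thesis using V add scale unfolding locally_convex_space_def by simp
qed

section \<open>Characters\<close>

text \<open>The difference \<open>k\<close> of \<open>h\<close> and the candidate vanishes at the
  integers, so it has period \<open>1\<close> and is bounded on the whole line. A bounded additive
  function is \<open>0\<close>.\<close>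

lemma additive_bounded_on_unit_interval_imp_linear:
  fixes h :: "real \<Rightarrow> real"
  assumes add: "\<And>s t. h (s + t) = h s + h t"
    and bd: "\<And>t. 0 \<le> t \<Longrightarrow> t \<le> 1 \<Longrightarrow> \<bar>h t\<bar> \<le> M"
  shows "h t = h 1 * t"
proof -
  define k where "k t = h t - h 1 * t" for t
  have kadd: "k (s + t) = k s + k t" for s t by (simp add: k_def add algebra_simps)
  have k0: "k 0 = 0" using kadd[of 0 0] by simp
  have km: "k (- t) = - k t" for t using kadd[of t "- t"] k0 by simp
  have k1: "k 1 = 0" by (simp add: k_def)
  have kn: "k (real n * t) = real n * k t" for n t
    by (induction n) (simp_all add: k0 kadd distrib_right)
  have kint: "k (of_int m) = 0" for m
    by (cases m rule: int_cases2) (use kn[of _ 1] k1 km in simp_all)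
  have kb: "\<bar>k t\<bar> \<le> M + \<bar>h 1\<bar>" for t
  proof -
    have "k t = k (frac t)"
      using kadd[of "frac t" "of_int \<lfloor>t\<rfloor>"] kint by (simp add: frac_def)
    moreover have "\<bar>k s\<bar> \<le> M + \<bar>h 1\<bar>" if "0 \<le> s" "s \<le> 1" for s
    proof -
      have "\<bar>h 1 * s\<bar> \<le> \<bar>h 1\<bar>" using that by (simp add: abs_mult mult_left_le)
      then show ?thesis using bd[OF that] unfolding k_def by linarith
    qed
    ultimately show ?thesis using frac_ge_0[of t] frac_lt_1[of t] by simp
  qed
  have "k t = 0"
  proof (rule ccontr)
    assume "k t \<noteq> 0"
    then obtain n where "real n * \<bar>k t\<bar> > M + \<bar>h 1\<bar>"
      using reals_Archimedean3[of "\<bar>k t\<bar>"] by auto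
    then show False using kb[of "real n * t"] kn[of n t] by (simp add: abs_mult)
  qed
  then show ?thesis by (simp add: k_def)
qed

text \<open>The line is contractible, so \<open>\<kappa>\<close> has a continuous logarithm. Its
  imaginary part is additive up to a continuous defect with values in the multiples of
  \<open>2 * pi\<close>, which is therefore constant.\<close>

lemma circle_character_of_real:
  fixes \<kappa> :: "real \<Rightarrow> complex"
  assumes cont: "continuous_on UNIV \<kappa>" and norm: "\<And>t. norm (\<kappa> t) = 1"
    and hom: "\<And>s t. \<kappa> (s + t) = \<kappa> s * \<kappa> t"
  shows "\<exists>a. \<forall>t. \<kappa> t = cis (a * t)"
proof -
  have nz: "\<kappa> t \<noteq> 0" for t using norm[of t] by auto
  obtain g where g: "continuous_on UNIV g" "\<And>t. \<kappa> t = exp (g t)"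
    using continuous_logarithm_on_contractible[OF cont convex_imp_contractible[OF convex_UNIV]] nz
    by auto
  \<comment> \<open>Subtracting the value at \<open>0\<close> makes \<open>h 0 = 0\<close>, so that
    the constant defect \<open>D\<close> is \<open>D 0 = 0\<close>.\<close>
  define h where "h t = Im (g t) - Im (g 0)" for t
  have Re0: "Re (g t) = 0" for t using norm[of t] g(2)[of t] by (simp add: norm_exp_eq_Re)
  have \<kappa>g: "\<kappa> t = cis (Im (g t))" for t using g(2)[of t] Re0[of t] by (simp add: exp_eq_polar)
  have \<kappa>0: "\<kappa> 0 = 1" using hom[of 0 0] nz[of 0] by simp
  have \<kappa>h: "\<kappa> t = cis (h t)" for t
    using \<kappa>g[of t] \<kappa>g[of 0] \<kappa>0 by (simp add: h_def flip: cis_divide)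
  have ch: "continuous_on UNIV h" unfolding h_def by (intro continuous_intros g(1))
  have add: "h (s + t) = h s + h t" for s t
  proof -
    define D where "D t = h (s + t) - h s - h t" for t
    have cD: "continuous_on UNIV D"
      unfolding D_def by (intro continuous_intros continuous_on_compose2[OF ch]) auto
    have "cis (D t) = 1" for t
      using hom[of s t] nz[of s] nz[of t] by (simp add: D_def \<kappa>h flip: cis_divide)
    then have "cos (D t) = 1" for t by (metis cis.simps(1) one_complex.simps(1))
    then have *: "\<exists>n::int. D t = 2 * pi * of_int n" for t
      by (metis cos_one_2pi_int mult.commute mult.assoc)
    have "D constant_on UNIV"
    proof (rule continuous_discrete_range_constant[OF connected_UNIV cD])
      fix x :: real
      have "2 * pi \<le> norm (D y - D x)" if "D y \<noteq> D x" for y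
      proof -
        obtain m n :: int where mn: "D x = 2 * pi * of_int m" "D y = 2 * pi * of_int n"
          using * by meson
        then have "m \<noteq> n" using that by auto
        then have "1 \<le> \<bar>real_of_int n - of_int m\<bar>" by linarith
        moreover have "norm (D y - D x) = 2 * pi * \<bar>real_of_int n - of_int m\<bar>"
          unfolding mn by (simp add: abs_mult flip: right_diff_distrib)
        ultimately show ?thesis by simp
      qed
      then show "\<exists>e>0. \<forall>y. y \<in> UNIV \<and> D y \<noteq> D x \<longrightarrow> e \<le> norm (D y - D x)"
        using pi_gt_zero by (intro exI[of _ "2 * pi"]) auto
    qed
    then have "D t = D 0" by (auto simp: constant_on_def)
    then show ?thesis by (simp add: D_def h_def)
  qed
  have "bounded (h ` {0..1})"
    using ch by (intro compact_imp_bounded compact_continuous_image)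
      (auto intro: continuous_on_subset)
  then obtain M where "\<forall>x\<in>h ` {0..1}. norm x \<le> M" unfolding bounded_iff by blast
  then have "\<bar>h t\<bar> \<le> M" if "0 \<le> t" "t \<le> 1" for t using that by simp
  then have "h t = h 1 * t" for t
    using additive_bounded_on_unit_interval_imp_linear[OF add] by blast
  then show ?thesis using \<kappa>h by metis
qed

text \<open>For \<open>a \<noteq> b\<close> the two sides at \<open>t = pi / (a - b)\<close> would
  differ by the factor \<open>cis pi = -1\<close>.\<close>

lemma cis_mult_eq_imp_eq:
  assumes "\<And>t. cis (a * t) = cis (b * t)"
  shows "a = b"
proof (rule ccontr)
  assume "a \<noteq> b"
  moreover have "cis (a * (pi / (a - b)) - b * (pi / (a - b))) = 1"
    using assms[of "pi / (a - b)"] by (simp flip: cis_divide)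
  moreover have "a * (pi / (a - b)) - b * (pi / (a - b)) = pi" if "a \<noteq> b"
    using that by (simp add: divide_simps) (simp add: algebra_simps)
  ultimately show False by simp
qed

lemma restrict_cis_in_characters:
  assumes "subspace (topspace T)" "cont_linear T f"
  shows "restrict (\<lambda>v. cis (f v)) (topspace T) \<in> characters T"
proof -
  have "continuous_map T euclidean (\<lambda>v. cis (f v))"
    using assms(2) continuous_map_compose[of T euclideanreal f euclidean cis]
    by (auto simp: cont_linear_def o_def continuous_on_cis)
  then have "continuous_map T (top_of_set unit_circle) (\<lambda>v. cis (f v))"
    by (simp add: continuous_map_in_subtopology image_subset_iff)
  then have "continuous_map T (top_of_set unit_circle) (restrict (\<lambda>v. cis (f v)) (topspace T))"
    by (rule continuous_map_eq) auto
  then show ?thesis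
    using assms unfolding characters_def
    by (auto simp: cont_linear_def linear_map_on_def cis_mult subspace_add)
qed

text \<open>On each line through \<open>0\<close> the character is \<open>cis\<close> of a multiple
  of the parameter, and \<open>f v\<close> is that slope. Slopes are unique, which makes
  \<open>f\<close> linear; local convexity makes it continuous.\<close>

lemma character_lift:
  assumes T: "locally_convex_space T" and \<kappa>: "\<kappa> \<in> characters T"
  obtains f where "cont_linear T f" "\<kappa> = restrict (\<lambda>v. cis (f v)) (topspace T)"
proof -
  let ?V = "topspace T"
  note V = lcs_subspace[OF T]
  have hom: "\<kappa> (x + y) = \<kappa> x * \<kappa> y" if "x \<in> ?V" "y \<in> ?V" for x y
    using \<kappa> that by (simp add: characters_def)
  have ext: "\<kappa> \<in> extensional ?V" using \<kappa> by (simp add: characters_def)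
  have "continuous_map T (top_of_set unit_circle) \<kappa>" using \<kappa> by (simp add: characters_def)
  then have cont: "continuous_map T euclidean \<kappa>" and norm: "\<And>v. v \<in> ?V \<Longrightarrow> norm (\<kappa> v) = 1"
    by (auto simp: continuous_map_in_subtopology)
  have "\<exists>a. \<forall>t. \<kappa> (t *\<^sub>R v) = cis (a * t)" if v: "v \<in> ?V" for v
  proof (rule circle_character_of_real)
    have "continuous_map euclideanreal T (\<lambda>t. t *\<^sub>R v)"
      using continuous_map_scaleR[OF T, of euclideanreal "\<lambda>t. t" "\<lambda>_. v"] v by simp
    from continuous_map_compose[OF this cont]
    show "continuous_on UNIV (\<lambda>t. \<kappa> (t *\<^sub>R v))" by (simp add: o_def)
    show "norm (\<kappa> (t *\<^sub>R v)) = 1" for t using norm subspace_scale[OF V v] by blast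
    show "\<kappa> ((s + t) *\<^sub>R v) = \<kappa> (s *\<^sub>R v) * \<kappa> (t *\<^sub>R v)" for s t
      using hom subspace_scale[OF V v] by (simp add: scaleR_left_distrib)
  qed
  then obtain f where f: "\<And>v t. v \<in> ?V \<Longrightarrow> \<kappa> (t *\<^sub>R v) = cis (f v * t)" by metis
  have lin: "linear_map_on ?V f"
    unfolding linear_map_on_def
  proof (intro conjI ballI allI)
    fix x y assume xy: "x \<in> ?V" "y \<in> ?V"
    have "cis (f (x + y) * t) = cis ((f x + f y) * t)" for t
      using f[OF xy(1), of t] f[OF xy(2), of t] f[OF subspace_add[OF V xy], of t]
        hom[OF subspace_scale[OF V xy(1), of t] subspace_scale[OF V xy(2), of t]]
      by (simp add: scaleR_right_distrib distrib_right cis_mult)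
    then show "f (x + y) = f x + f y" by (rule cis_mult_eq_imp_eq)
  next
    fix c x assume x: "x \<in> ?V"
    have "cis (f (c *\<^sub>R x) * t) = cis ((c *\<^sub>R f x) * t)" for t
      using f[OF x, of "t * c"] f[OF subspace_scale[OF V x], of t c] by (simp add: ac_simps)
    then show "f (c *\<^sub>R x) = c *\<^sub>R f x" by (rule cis_mult_eq_imp_eq)
  qed
  have \<kappa>f: "\<kappa> v = cis (f v)" if "v \<in> ?V" for v using f[OF that, of 1] by simp
  let ?U = "{v \<in> ?V. \<kappa> v \<in> {z. Re z > 0}}"
  have "open {z. Re z > 0}" by (simp add: open_halfspace_Re_gt)
  then have U: "openin T ?U" by (intro openin_continuous_map_preimage[OF cont]) simp
  have 0: "0 \<in> ?V" using V by (rule subspace_0)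
  then have "0 \<in> ?U" using f[OF 0, of 0] by simp
  then obtain W C where C: "openin T W" "convex C" "0 \<in> W" "W \<subseteq> C" "C \<subseteq> ?U"
    using T U unfolding locally_convex_space_def neighbourhood_base_at_def by meson
  \<comment> \<open>If \<open>\<bar>f v\<bar> > pi\<close>, the segment from \<open>0\<close> to
    \<open>v\<close>, which stays in \<open>C\<close>, passes a point with \<open>f = pi\<close> or
    \<open>f = - pi\<close>. There \<open>\<kappa>\<close> is \<open>-1\<close>, but its real part
    is positive on \<open>C\<close>.\<close>
  have "\<bar>f v\<bar> \<le> pi" if v: "v \<in> W" for v
  proof (rule ccontr)
    assume "\<not> \<bar>f v\<bar> \<le> pi"
    then have big: "\<bar>f v\<bar> > pi" by simp
    have vV: "v \<in> ?V" using v C by auto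
    define t where "t = pi / \<bar>f v\<bar>"
    have t: "0 \<le> t" "t \<le> 1" using big pi_gt_zero by (auto simp: t_def divide_le_eq)
    have "(1 - t) *\<^sub>R 0 + t *\<^sub>R v \<in> C"
      by (rule convexD[OF C(2)]) (use C v t in auto)
    then have "t *\<^sub>R v \<in> ?U" using C(5) by auto
    then have "cos (f v * t) > 0" using f[OF vV, of t] by simp
    moreover have "f v * t = pi \<or> f v * t = - pi" using big pi_gt_zero by (auto simp: t_def abs_if)
    ultimately show False by auto
  qed
  then have "cont_linear T f" by (rule cont_linearI_bounded[OF T lin C(1,3)])
  moreover have "\<kappa> = restrict (\<lambda>v. cis (f v)) ?V"
    using \<kappa>f ext by (intro extensionalityI[of _ ?V]) auto
  ultimately show thesis by (rule that)
qed

text \<open>Reduces the comparison of character groups to that of continuous functionals.\<close>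

lemma characters_eq:
  assumes "locally_convex_space T"
  shows "characters T = (\<lambda>f. restrict (\<lambda>v. cis (f v)) (topspace T)) ` {f. cont_linear T f}"
proof
  show "characters T \<subseteq> (\<lambda>f. restrict (\<lambda>v. cis (f v)) (topspace T)) ` {f. cont_linear T f}"
    by (auto elim: character_lift[OF assms])
  show "(\<lambda>f. restrict (\<lambda>v. cis (f v)) (topspace T)) ` {f. cont_linear T f} \<subseteq> characters T"
    using restrict_cis_in_characters[OF lcs_subspace[OF assms]] by auto
qed

lemma quasi_convex_polar:
  assumes V: "subspace (topspace T)" and \<Phi>: "\<And>f. f \<in> \<Phi> \<Longrightarrow> cont_linear T f" and d: "d > 0"
  shows "quasi_convex T {v \<in> topspace T. \<forall>f\<in>\<Phi>. \<bar>f v\<bar> \<le> d}"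
  unfolding quasi_convex_def
proof (intro conjI ballI)
  let ?V = "topspace T" and ?A = "{v \<in> topspace T. \<forall>f\<in>\<Phi>. \<bar>f v\<bar> \<le> d}"
  fix g assume "g \<in> ?V - ?A"
  then obtain f where f: "g \<in> ?V" "f \<in> \<Phi>" "\<bar>f g\<bar> > d" by auto
  \<comment> \<open>The plain scale \<open>pi / 2 / d\<close> could wind \<open>f g\<close> once
    around the circle and back into the right half. The maximum with
    \<open>\<bar>f g\<bar> / 2\<close> keeps \<open>s * \<bar>f g\<bar>\<close> in the interval from
    \<open>pi / 2\<close>, exclusive, to \<open>pi\<close>, while \<open>?A\<close> still goes into
    the right half.\<close>
  define s where "s = pi / 2 / max d (\<bar>f g\<bar> / 2)"
  have m: "max d (\<bar>f g\<bar> / 2) > 0" using d by simp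
  have s: "s > 0" using m unfolding s_def by simp
  have "cont_linear T (\<lambda>v. s * f v)"
    using \<Phi>[OF f(2)] unfolding cont_linear_def linear_map_on_def
    by (auto simp: algebra_simps intro!: continuous_map_real_mult_left)
  then have \<kappa>: "restrict (\<lambda>v. cis (s * f v)) ?V \<in> characters T"
    by (rule restrict_cis_in_characters[OF V])
  have "\<bar>f g\<bar> > max d (\<bar>f g\<bar> / 2)" using f d by simp
  then have "pi / 2 < s * \<bar>f g\<bar>" using m pi_gt_zero by (simp add: s_def field_simps)
  moreover have "s * \<bar>f g\<bar> \<le> s * (2 * max d (\<bar>f g\<bar> / 2))"
    using s by (intro mult_left_mono) auto
  moreover have "s * (2 * max d (\<bar>f g\<bar> / 2)) = pi" using m by (simp add: s_def field_simps)
  ultimately have "cos (s * \<bar>f g\<bar>) < cos (pi / 2)"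
    by (intro cos_monotone_0_pi) (use pi_gt_zero in auto)
  then have neg: "cos (s * f g) < 0" by (simp add: abs_if split: if_splits)
  have pos: "cos (s * f v) \<ge> 0" if "v \<in> ?A" for v
  proof -
    have "\<bar>f v\<bar> \<le> max d (\<bar>f g\<bar> / 2)" using that f(2) by auto
    then have "s * \<bar>f v\<bar> \<le> s * max d (\<bar>f g\<bar> / 2)" using s by simp
    also have "\<dots> = pi / 2" using m by (simp add: s_def field_simps)
    finally have "\<bar>s * f v\<bar> \<le> pi / 2" using s by (simp add: abs_mult)
    then show ?thesis by (intro cos_ge_zero) auto
  qed
  show "\<exists>\<phi>\<in>characters T. \<phi> g \<notin> right_half_circle \<and> \<phi> ` ?A \<subseteq> right_half_circle"
    by (rule bexI[OF _ \<kappa>]) (use f(1) neg pos in \<open>auto simp: right_half_circle_def\<close>)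
qed auto

lemma quasi_convex_Int:
  "quasi_convex T A \<Longrightarrow> quasi_convex T B \<Longrightarrow> quasi_convex T (A \<inter> B)"
  unfolding quasi_convex_def by (fastforce simp: image_subset_iff)

lemma quasi_convex_mono:
  "quasi_convex T A \<Longrightarrow> topspace N = topspace T \<Longrightarrow> characters T \<subseteq> characters N \<Longrightarrow> quasi_convex N A"
  unfolding quasi_convex_def by (metis subset_iff)

text \<open>A base is formed by the quasi-convex neighbourhoods of \<open>T\<close> cut with polars
  of \<open>\<Phi>\<close>. Both are quasi-convex for \<open>T\<close>, and this carries over
  because the characters of \<open>T\<close> survive the refinement.\<close>

lemma locally_quasi_convex_refine:
  assumes T: "locally_convex_space T" and qc: "locally_quasi_convex T"
    and \<Phi>: "\<And>f. f \<in> \<Phi> \<Longrightarrow> cont_linear T f" and bd: "pointwise_bounded (topspace T) \<Phi>"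
    and char: "characters T \<subseteq> characters (refine T \<Phi>)"
  shows "locally_quasi_convex (refine T \<Phi>)"
proof -
  let ?R = "refine T \<Phi>" and ?V = "topspace T"
  note V = lcs_subspace[OF T]
  have lin: "linear_map_on ?V f" if "f \<in> \<Phi>" for f using \<Phi>[OF that] by (simp add: cont_linear_def)
  have R: "locally_convex_space ?R" by (rule lcs_refine[OF T lin bd])
  have 0: "0 \<in> ?V" using V by (rule subspace_0)
  have "neighbourhood_base_at 0 (quasi_convex ?R) ?R"
    unfolding neighbourhood_base_at_def
  proof (intro allI impI)
    fix U assume "openin ?R U \<and> 0 \<in> U"
    then obtain W e where W: "openin T W" "0 \<in> W" "e > 0" "{y \<in> W. \<forall>f\<in>\<Phi>. \<bar>f (y - 0)\<bar> \<le> e} \<subseteq> U"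
      unfolding openin_refine by blast
    obtain W' A where A: "openin T W'" "quasi_convex T A" "0 \<in> W'" "W' \<subseteq> A" "A \<subseteq> W"
      using qc W(1,2) unfolding locally_quasi_convex_def neighbourhood_base_at_def by blast
    let ?P = "{v \<in> ?V. \<forall>f\<in>\<Phi>. \<bar>f v\<bar> \<le> e}"
    let ?O = "{y \<in> ?V. \<exists>d<e. \<forall>f\<in>\<Phi>. \<bar>f (y - 0)\<bar> \<le> d}"
    have "quasi_convex T (A \<inter> ?P)"
      by (rule quasi_convex_Int[OF A(2) quasi_convex_polar[OF V \<Phi> W(3)]])
    then have "quasi_convex ?R (A \<inter> ?P)" by (rule quasi_convex_mono) (use char in auto)
    moreover have "openin ?R (W' \<inter> ?O)"
      by (intro openin_Int openin_refineI A(1) openin_refine_small[OF V lin 0])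
    moreover have "0 \<in> W' \<inter> ?O"
      using A(3) 0 W(3) linear_map_on_0[OF V lin] by (auto intro!: exI[of _ 0])
    moreover have "W' \<inter> ?O \<subseteq> A \<inter> ?P" using A(4) by force
    moreover have "A \<inter> ?P \<subseteq> U" using A(5) W(4) by auto
    ultimately show "\<exists>O' B. openin ?R O' \<and> quasi_convex ?R B \<and> 0 \<in> O' \<and> O' \<subseteq> B \<and> B \<subseteq> U"
      by blast
  qed
  then show ?thesis
    unfolding locally_quasi_convex_def using lcs_abelian_topological_group[OF R] by simp
qed

section \<open>Discrete spaces\<close>

text \<open>For \<open>w\<close> in the right half circle
  \<open>Re (w\<^sup>2) = 2 * (Re w)\<^sup>2 - 1\<close> and \<open>0 \<le> Re w \<le> 1\<close>, so
  squaring at least doubles the gap \<open>1 - Re w\<close>. After \<open>n\<close> squarings the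
  gap is still at most \<open>1\<close>.\<close>

lemma one_minus_Re_le_if_powers_in_half_plane:
  assumes "norm z = 1" and "\<And>k. k \<le> n \<Longrightarrow> Re (z ^ (2 ^ k)) \<ge> 0"
  shows "1 - Re z \<le> 1 / 2 ^ n"
proof -
  have "(1 - Re z) * 2 ^ m \<le> 1 - Re (z ^ (2 ^ m))" if "m \<le> n" for m
    using that
  proof (induction m)
    case 0
    then show ?case by simp
  next
    case (Suc m)
    define w where "w = z ^ (2 ^ m)"
    have nw: "norm w = 1" by (simp add: w_def norm_power assms(1))
    then have "(Re w)\<^sup>2 + (Im w)\<^sup>2 = 1" by (simp add: cmod_def)
    moreover have "z ^ (2 ^ Suc m) = w\<^sup>2" by (simp add: w_def mult.commute flip: power_mult)
    moreover have "Re (w\<^sup>2) = (Re w)\<^sup>2 - (Im w)\<^sup>2" by (simp add: power2_eq_square)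
    ultimately have *: "Re (z ^ (2 ^ Suc m)) = 2 * (Re w)\<^sup>2 - 1" by simp
    have "Re w \<ge> 0" using assms(2)[of m] Suc.prems by (simp add: w_def)
    moreover have "Re w \<le> 1" using complex_Re_le_cmod[of w] nw by simp
    ultimately have "(Re w)\<^sup>2 \<le> Re w" by (simp add: power2_eq_square mult_left_le)
    then have "2 * (1 - Re w) \<le> 1 - Re (z ^ (2 ^ Suc m))" unfolding * by simp
    then show ?case using Suc by (simp add: w_def)
  qed
  from this[of n] have "(1 - Re z) * 2 ^ n \<le> 1" using assms(2)[of n] by simp
  then show ?thesis by (simp add: field_simps)
qed

text \<open>If the first \<open>n\<close> iterated doubles of \<open>v\<close> stay in
  \<open>U\<close>, the iterated squares of \<open>\<kappa> v\<close> stay in the right half circle,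
  so \<open>\<kappa> v\<close> is within a controlled distance of \<open>1\<close>. Only the group
  operation is involved.\<close>

lemma character_if_half_circle_neighbourhood:
  assumes N: "abelian_topological_group N"
    and ext: "\<kappa> \<in> extensional (topspace N)" and norm: "\<And>x. x \<in> topspace N \<Longrightarrow> norm (\<kappa> x) = 1"
    and hom: "\<And>x y. x \<in> topspace N \<Longrightarrow> y \<in> topspace N \<Longrightarrow> \<kappa> (x + y) = \<kappa> x * \<kappa> y"
    and U: "openin N U" "0 \<in> U" and pos: "\<And>v. v \<in> U \<Longrightarrow> Re (\<kappa> v) \<ge> 0"
  shows "\<kappa> \<in> characters N"
proof -
  let ?V = "topspace N" and ?D = "\<lambda>k. ((\<lambda>v :: 'a. v + v) ^^ k)"
  have cD: "continuous_map N N (?D k)" for k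
  proof (induction k)
    case 0
    then show ?case by (simp add: id_def)
  next
    case (Suc k)
    then show ?case using continuous_map_add[OF N Suc Suc] by (simp add: o_def)
  qed
  have D0: "?D k 0 = 0" for k by (induction k) auto
  have \<kappa>D: "\<kappa> (?D k v) = \<kappa> v ^ (2 ^ k)" if "v \<in> ?V" for k v
  proof (induction k)
    case (Suc k)
    have "?D k v \<in> ?V" using continuous_map_image_subset_topspace[OF cD[of k]] that by blast
    then show ?case using Suc hom by (simp add: power_add mult_2)
  qed simp
  have "continuous_map N euclidean \<kappa>"
  proof (rule continuous_mapI_translate[OF N])
    fix e :: real assume e: "e > 0"
    \<comment> \<open>On the unit circle the squared distance of \<open>\<kappa> v\<close> from
      \<open>1\<close> is \<open>2 * (1 - Re (\<kappa> v))\<close>; hence the target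
      \<open>e\<^sup>2 / 2\<close>.\<close>
    obtain n where n: "(1/2) ^ n < e\<^sup>2 / 2" using real_arch_pow_inv[of "e\<^sup>2/2" "1/2"] e by auto
    let ?W = "\<Inter>k\<in>{..n}. {v \<in> ?V. ?D k v \<in> U}"
    have "openin N ?W"
      by (rule openin_INT2) (use openin_continuous_map_preimage[OF cD U(1)] in auto)
    moreover have "0 \<in> ?W" using D0 U abelian_topological_group_closed(1)[OF N] by auto
    moreover have "dist (\<kappa> (x + v)) (\<kappa> x) < e" if x: "x \<in> ?V" and v: "v \<in> ?W" for x v
    proof -
      have vV: "v \<in> ?V" using v by auto
      have "Re (\<kappa> v ^ 2 ^ k) \<ge> 0" if "k \<le> n" for k
        using v pos[of "?D k v"] \<kappa>D[OF vV, of k] that by simp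
      then have "1 - Re (\<kappa> v) \<le> 1 / 2 ^ n"
        by (intro one_minus_Re_le_if_powers_in_half_plane norm[OF vV])
      then have small: "1 - Re (\<kappa> v) < e\<^sup>2 / 2" using n by (simp add: power_one_over)
      have "(Re (\<kappa> v))\<^sup>2 + (Im (\<kappa> v))\<^sup>2 = 1" using norm[OF vV] by (simp add: cmod_def)
      then have "(norm (\<kappa> v - 1))\<^sup>2 = 2 * (1 - Re (\<kappa> v))"
        by (simp add: cmod_power2 power2_diff)
      also have "\<dots> < e\<^sup>2" using small by simp
      finally have "norm (\<kappa> v - 1) < e" using e by (simp add: power2_less_imp_less)
      moreover have "\<kappa> (x + v) - \<kappa> x = \<kappa> x * (\<kappa> v - 1)" using hom[OF x vV] by (simp add: algebra_simps)
      ultimately show ?thesis using norm[OF x] by (simp add: dist_norm norm_mult)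
    qed
    ultimately show "\<exists>W. openin N W \<and> 0 \<in> W \<and> (\<forall>x\<in>?V. \<forall>v\<in>W. dist (\<kappa> (x + v)) (\<kappa> x) < e)"
      by (intro exI[of _ ?W]) blast
  qed
  then have "continuous_map N (top_of_set unit_circle) \<kappa>"
    using norm by (auto simp: continuous_map_in_subtopology)
  then show ?thesis using ext hom by (simp add: characters_def)
qed

text \<open>Nested intervals: the solutions of \<open>cos (a n * s) \<le> 0\<close> form intervals
  of length \<open>pi / a n\<close> that recur with period \<open>2 * pi / a n\<close>. An interval
  of length \<open>3 * pi / a (Suc n)\<close> contains a complete one of the next level, which is
  the origin of the factor \<open>3\<close>.\<close>

lemma lacunary_cos_nonpos:
  fixes a :: "nat \<Rightarrow> real"
  assumes pos: "\<And>n. a n > 0" and lac: "\<And>n. a (Suc n) \<ge> 3 * a n"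
  obtains s where "pi / 2 / a 0 \<le> s" "s \<le> 3 * pi / 2 / a 0" "\<And>n. cos (a n * s) \<le> 0"
proof -
  define l where "l n m = (pi / 2 + 2 * pi * of_int m) / a n" for n and m :: int
  define r where "r n m = (3 * pi / 2 + 2 * pi * of_int m) / a n" for n and m :: int
  have "\<exists>m'. l n m \<le> l (Suc n) m' \<and> r (Suc n) m' \<le> r n m" for n m
  proof (intro exI conjI)
    let ?b = "a (Suc n)"
    \<comment> \<open>Its ceiling is the index of the first interval of level \<open>Suc n\<close>
      that starts at or after \<open>l n m\<close>.\<close>
    let ?q = "(?b * l n m - pi / 2) / (2 * pi)"
    have q: "2 * pi * ?q = ?b * l n m - pi / 2" by simp
    have "2 * pi * ?q \<le> 2 * pi * of_int \<lceil>?q\<rceil>" by (intro mult_left_mono) auto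
    then have "?b * l n m \<le> pi / 2 + 2 * pi * of_int \<lceil>?q\<rceil>" unfolding q by simp
    then show "l n m \<le> l (Suc n) \<lceil>?q\<rceil>"
      unfolding l_def[of "Suc n"] pos_le_divide_eq[OF pos] by (simp only: mult.commute)
    have "2 * pi * of_int \<lceil>?q\<rceil> \<le> 2 * pi * (?q + 1)"
      by (intro mult_left_mono) (use ceiling_correct[of ?q] in linarith, simp)
    also have "\<dots> = 2 * pi * ?q + 2 * pi" by (simp only: distrib_left mult_1_right)
    finally have "3 * pi / 2 + 2 * pi * of_int \<lceil>?q\<rceil> \<le> ?b * l n m + 3 * pi" unfolding q by simp
    moreover have "3 * pi \<le> ?b * (pi / a n)"
      using lac[of n] pos[of n] by (simp add: pos_le_divide_eq)
    moreover have "?b * l n m + ?b * (pi / a n) = ?b * r n m"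
      by (simp add: l_def r_def add_divide_distrib algebra_simps)
    ultimately have "3 * pi / 2 + 2 * pi * of_int \<lceil>?q\<rceil> \<le> ?b * r n m" by linarith
    then show "r (Suc n) \<lceil>?q\<rceil> \<le> r n m"
      unfolding r_def[of "Suc n"] pos_divide_le_eq[OF pos] by (simp only: mult.commute)
  qed
  then have step: "\<exists>m'. True \<and> (l n m \<le> l (Suc n) m' \<and> r (Suc n) m' \<le> r n m)" for n m by blast
  \<comment> \<open>The invariant pins the first interval to \<open>m 0 = 0\<close>; this gives the
    bounds on \<open>s\<close>.\<close>
  obtain m where m: "\<And>n. (n = 0 \<longrightarrow> m n = 0) \<and> l n (m n) \<le> l (Suc n) (m (Suc n)) \<and> r (Suc n) (m (Suc n)) \<le> r n (m n)"
    using dependent_nat_choice[of "\<lambda>n m. n = 0 \<longrightarrow> m = 0" "\<lambda>n m m'. l n m \<le> l (Suc n) m' \<and> r (Suc n) m' \<le> r n m"]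
      step by auto
  have "\<Inter>(range (\<lambda>n. {l n (m n)..r n (m n)})) \<noteq> {}"
  proof (rule compact_nest)
    show "{l n (m n)..r n (m n)} \<noteq> {}" for n
      using pos[of n] pi_gt_zero by (simp add: l_def r_def divide_right_mono)
    show "{l n (m n)..r n (m n)} \<subseteq> {l k (m k)..r k (m k)}" if "k \<le> n" for k n
      using that
    proof (induction n rule: dec_induct)
      case (step n)
      then show ?case using m[of n] by auto
    qed simp
  qed simp
  then obtain s where s: "\<And>n. l n (m n) \<le> s \<and> s \<le> r n (m n)" by force
  have "cos (a n * s) \<le> 0" for n
  proof -
    have "pi / 2 + 2 * pi * of_int (m n) \<le> a n * s" "a n * s \<le> 3 * pi / 2 + 2 * pi * of_int (m n)"
      using s[of n] pos[of n] by (simp_all add: l_def r_def pos_divide_le_eq pos_le_divide_eq mult.commute)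
    then have "cos (a n * s - 2 * pi * of_int (m n) - pi) \<ge> 0" by (intro cos_ge_zero) auto
    moreover have "cos (a n * s - 2 * pi * of_int (m n) - pi) = - cos (a n * s - 2 * pi * of_int (m n))"
      by (simp add: cos_diff)
    moreover have "cos (a n * s - 2 * pi * of_int (m n)) = cos (a n * s)"
      by (simp add: cos_diff)
    ultimately show ?thesis by simp
  qed
  moreover have "pi / 2 / a 0 \<le> s" "s \<le> 3 * pi / 2 / a 0"
    using s[of 0] m[of 0] by (simp_all add: l_def r_def)
  ultimately show thesis by (rule that[rotated 2])
qed

lemma closedin_Collect_ball:
  assumes "\<And>i. i \<in> I \<Longrightarrow> closedin X {x \<in> topspace X. Q i x}"
  shows "closedin X {x \<in> topspace X. \<forall>i\<in>I. Q i x}"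
proof (cases "I = {}")
  case False
  then have "{x \<in> topspace X. \<forall>i\<in>I. Q i x} = (\<Inter>i\<in>I. {x \<in> topspace X. Q i x})" by auto
  then show ?thesis using False assms by (simp add: closedin_INT)
qed simp

text \<open>If the functionals were unbounded at \<open>x\<close>, then a lacunary sequence of them together with
  compactness would give a character that is continuous for \<open>N\<close> but has nonpositive real part at
  points \<open>s x\<close> with arbitrarily small \<open>s > 0\<close>.\<close>

lemma pointwise_bounded_if_characters_subset:
  assumes L: "locally_convex_space L" and N: "abelian_topological_group N"
    and top: "topspace N = topspace L" and char: "characters N \<subseteq> characters L"
    and U: "openin N U" "0 \<in> U"
  shows "pointwise_bounded (topspace L) {f. cont_linear L f \<and> (\<forall>v\<in>U. cos (f v) \<ge> 0)}"
    (is "pointwise_bounded ?V ?\<Phi>")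
  unfolding pointwise_bounded_def
proof (intro ballI, rule ccontr)
  fix x assume x: "x \<in> ?V" and "\<not> (\<exists>M. \<forall>f\<in>?\<Phi>. \<bar>f x\<bar> \<le> M)"
  then have unb: "\<exists>f\<in>?\<Phi>. \<bar>f x\<bar> > M" for M by (meson not_le)
  note V = lcs_subspace[OF L]
  have UV: "U \<subseteq> ?V" using openin_subset[OF U(1)] top by simp
  \<comment> \<open>Tripling is the growth demanded by \<open>lacunary_cos_nonpos\<close>; starting
    above \<open>1\<close> it also forces \<open>\<bar>F n x\<bar> > real n\<close>.\<close>
  have "\<exists>F. \<forall>n. (F n \<in> ?\<Phi> \<and> \<bar>F n x\<bar> > 1) \<and> \<bar>F (Suc n) x\<bar> \<ge> 3 * \<bar>F n x\<bar>"
  proof (rule dependent_nat_choice)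
    show "\<exists>f. f \<in> ?\<Phi> \<and> \<bar>f x\<bar> > 1" using unb[of 1] by blast
    fix f :: "'a \<Rightarrow> real" and n :: nat
    show "\<exists>g. (g \<in> ?\<Phi> \<and> \<bar>g x\<bar> > 1) \<and> \<bar>g x\<bar> \<ge> 3 * \<bar>f x\<bar>"
      using unb[of "1 + 3 * \<bar>f x\<bar>"] by force
  qed
  then obtain F where F: "\<And>n. F n \<in> ?\<Phi>" "\<And>n. \<bar>F n x\<bar> > 1" "\<And>n. \<bar>F (Suc n) x\<bar> \<ge> 3 * \<bar>F n x\<bar>"
    by blast
  have grow: "\<bar>F n x\<bar> > real n" for n
  proof (induction n)
    case (Suc n)
    then show ?case using F(2)[of n] F(3)[of n] by simp
  qed (use F(2)[of 0] in simp)
  have "\<exists>s m. 0 < s \<and> s < e \<and> (\<forall>n\<ge>m. cos (F n (s *\<^sub>R x)) \<le> 0)" if e: "e > 0" for e :: real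
  proof -
    \<comment> \<open>The sequence from index \<open>m\<close> on is again lacunary, and its common
      solution \<open>s\<close> is at most \<open>3 * pi / 2 / \<bar>F m x\<bar>\<close>; a large
      \<open>m\<close> pushes it below \<open>e\<close>.\<close>
    obtain m :: nat where m: "real m > 3 * pi / 2 / e" using reals_Archimedean2 by blast
    have big: "\<bar>F m x\<bar> > 3 * pi / 2 / e" using m grow[of m] by simp
    have "\<bar>F (m + n) x\<bar> > 0" "\<bar>F (m + Suc n) x\<bar> \<ge> 3 * \<bar>F (m + n) x\<bar>" for n
      using F(2,3)[of "m + n"] by auto
    from lacunary_cos_nonpos[of "\<lambda>n. \<bar>F (m + n) x\<bar>", OF this]
    obtain s where s: "pi / 2 / \<bar>F (m + 0) x\<bar> \<le> s" "s \<le> 3 * pi / 2 / \<bar>F (m + 0) x\<bar>"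
      "\<And>n. cos (\<bar>F (m + n) x\<bar> * s) \<le> 0" by blast
    have Fm: "\<bar>F m x\<bar> > 0" using F(2)[of m] by linarith
    have "0 < pi / 2 / \<bar>F m x\<bar>" using Fm by simp
    then have "s > 0" using s(1) by simp
    moreover have "3 * pi / 2 / \<bar>F m x\<bar> < e" using big Fm e by (simp add: field_simps)
    then have "s < e" using s(2) by simp
    moreover have "cos (F n (s *\<^sub>R x)) \<le> 0" if "n \<ge> m" for n
    proof -
      have "F n (s *\<^sub>R x) = s * F n x"
        using F(1)[of n] x by (simp add: cont_linear_def linear_map_on_def)
      then have "cos (F n (s *\<^sub>R x)) = cos (\<bar>F n x\<bar> * s)"
        by (simp add: abs_if mult.commute)
      then show ?thesis using s(3)[of "n - m"] that by simp
    qed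
    ultimately show ?thesis by blast
  qed
  then have "\<forall>j. \<exists>s m. 0 < s \<and> s < 1 / real (Suc j) \<and> (\<forall>n\<ge>m. cos (F n (s *\<^sub>R x)) \<le> 0)" by simp
  then obtain s m where s: "\<And>j. 0 < s j" "\<And>j. s j < 1 / real (Suc j)"
    and sm: "\<And>j n. n \<ge> m j \<Longrightarrow> cos (F n (s j *\<^sub>R x)) \<le> 0"
    by metis
  define P where "P = product_topology (\<lambda>_::'a. top_of_set unit_circle) ?V"
  have "compact_space (top_of_set unit_circle)" by (simp add: compact_space_subtopology)
  then have compP: "compact_space P" by (simp add: P_def compact_space_product_topology)
  have proj: "continuous_map P euclidean (\<lambda>\<kappa>. \<kappa> v)" if "v \<in> ?V" for v
    using continuous_map_product_projection[OF that, of "\<lambda>_. top_of_set unit_circle"]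
    by (simp add: P_def continuous_map_in_subtopology)
  \<comment> \<open>Circle-valued homomorphisms, continuous or not, that satisfy the constraint on
    \<open>U\<close> and stay away from \<open>1\<close> at the first \<open>Suc k\<close> short
    multiples of \<open>x\<close>. These conditions are closed in a compact product.\<close>
  define K where "K k = {\<kappa> \<in> topspace P. (\<forall>(x, y)\<in>?V \<times> ?V. \<kappa> (x + y) = \<kappa> x * \<kappa> y)} \<inter>
      {\<kappa> \<in> topspace P. \<forall>v\<in>U. Re (\<kappa> v) \<ge> 0} \<inter> {\<kappa> \<in> topspace P. \<forall>j\<in>{..k}. Re (\<kappa> (s j *\<^sub>R x)) \<le> 0}" for k
  have closed: "closedin P (K k)" for k
    unfolding K_def
  proof (intro closedin_Int closedin_Collect_ball)
    fix p assume "p \<in> ?V \<times> ?V"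
    then obtain y z where p: "p = (y, z)" "y \<in> ?V" "z \<in> ?V" by auto
    have "continuous_map P (prod_topology euclidean euclidean) (\<lambda>\<kappa>. (\<kappa> (y + z), \<kappa> y * \<kappa> z))"
    proof (rule continuous_map_pairedI)
      show "continuous_map P euclidean (\<lambda>\<kappa>. \<kappa> (y + z))" using proj subspace_add[OF V p(2,3)] by blast
      have "continuous_map P (prod_topology euclidean euclidean) (\<lambda>\<kappa>. (\<kappa> y, \<kappa> z))"
        using proj p by (intro continuous_map_pairedI) auto
      moreover have "continuous_map (prod_topology euclidean euclidean) euclidean (\<lambda>(a, b). a * b :: complex)"
        by (simp add: case_prod_unfold continuous_intros)
      ultimately have "continuous_map P euclidean ((\<lambda>(a, b). a * b) \<circ> (\<lambda>\<kappa>. (\<kappa> y, \<kappa> z)))"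
        by (rule continuous_map_compose)
      then show "continuous_map P euclidean (\<lambda>\<kappa>. \<kappa> y * \<kappa> z)" by (simp add: o_def)
    qed
    moreover have "closedin (prod_topology euclidean euclidean) {q :: complex \<times> complex. fst q = snd q}"
      by (simp add: closed_Collect_eq continuous_intros)
    ultimately have "closedin P {\<kappa> \<in> topspace P. (\<kappa> (y + z), \<kappa> y * \<kappa> z) \<in> {q. fst q = snd q}}"
      by (rule closedin_continuous_map_preimage)
    then show "closedin P {\<kappa> \<in> topspace P. case p of (x, y) \<Rightarrow> \<kappa> (x + y) = \<kappa> x * \<kappa> y}"
      by (simp add: p)
  next
    fix v assume "v \<in> U"
    then have "continuous_map P euclidean (\<lambda>\<kappa>. \<kappa> v)" using UV by (intro proj) auto
    moreover have "closedin euclidean {z. Re z \<ge> 0}" by (simp add: closed_halfspace_Re_ge)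
    ultimately have "closedin P {\<kappa> \<in> topspace P. \<kappa> v \<in> {z. Re z \<ge> 0}}"
      by (rule closedin_continuous_map_preimage)
    then show "closedin P {\<kappa> \<in> topspace P. Re (\<kappa> v) \<ge> 0}" by simp
  next
    fix j
    have "continuous_map P euclidean (\<lambda>\<kappa>. \<kappa> (s j *\<^sub>R x))" using subspace_scale[OF V x] by (rule proj)
    moreover have "closedin euclidean {z. Re z \<le> 0}" by (simp add: closed_halfspace_Re_le)
    ultimately have "closedin P {\<kappa> \<in> topspace P. \<kappa> (s j *\<^sub>R x) \<in> {z. Re z \<le> 0}}"
      by (rule closedin_continuous_map_preimage)
    then show "closedin P {\<kappa> \<in> topspace P. Re (\<kappa> (s j *\<^sub>R x)) \<le> 0}" by simp
  qed
  have ne: "K k \<noteq> {}" for k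
  proof -
    \<comment> \<open>One functional far enough out in the sequence serves all points
      \<open>s j *\<^sub>R x\<close> with \<open>j \<le> k\<close>.\<close>
    define n where "n = Max (m ` {..k})"
    have n: "m j \<le> n" if "j \<le> k" for j using that by (simp add: n_def)
    let ?\<kappa> = "restrict (\<lambda>v. cis (F n v)) ?V"
    have "?\<kappa> \<in> topspace P" by (auto simp: P_def PiE_def)
    moreover have "?\<kappa> (y + z) = ?\<kappa> y * ?\<kappa> z" if "y \<in> ?V" "z \<in> ?V" for y z
      using F(1)[of n] that subspace_add[OF V that] by (simp add: cont_linear_def linear_map_on_def cis_mult)
    moreover have "Re (?\<kappa> v) \<ge> 0" if "v \<in> U" for v using F(1)[of n] that UV by auto
    moreover have "Re (?\<kappa> (s j *\<^sub>R x)) \<le> 0" if "j \<le> k" for j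
      using sm[OF n[OF that]] subspace_scale[OF V x] by simp
    ultimately have "?\<kappa> \<in> K k" unfolding K_def by auto
    then show ?thesis by auto
  qed
  have "decseq K" unfolding K_def decseq_def by auto
  then obtain \<kappa> where \<kappa>: "\<And>k. \<kappa> \<in> K k"
    using compact_space_imp_nest[of P K] compP closed ne by blast
  have \<kappa>P: "\<kappa> \<in> topspace P" using \<kappa>[of 0] by (simp add: K_def)
  \<comment> \<open>Compactness yields \<open>\<kappa>\<close> without continuity. The constraint on
    \<open>U\<close> supplies continuity for \<open>N\<close>, and \<open>char\<close> carries it
    over to \<open>L\<close>.\<close>
  have "\<kappa> \<in> characters N"
  proof (rule character_if_half_circle_neighbourhood[OF N _ _ _ U])
    show "\<kappa> \<in> extensional (topspace N)" using \<kappa>P by (auto simp: P_def top PiE_def)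
    show "norm (\<kappa> x) = 1" if "x \<in> topspace N" for x
      using \<kappa>P that by (auto simp: P_def top PiE_iff)
    show "\<kappa> (x + y) = \<kappa> x * \<kappa> y" if "x \<in> topspace N" "y \<in> topspace N" for x y
      using \<kappa>[of 0] that by (auto simp: K_def top)
    show "Re (\<kappa> v) \<ge> 0" if "v \<in> U" for v using \<kappa>[of 0] that by (auto simp: K_def)
  qed
  then obtain f where f: "cont_linear L f" "\<kappa> = restrict (\<lambda>v. cis (f v)) ?V"
    using char character_lift[OF L] by blast
  \<comment> \<open>With \<open>s j < 1 / real (Suc j)\<close> this gives
    \<open>\<bar>s j * f x\<bar> \<le> 1\<close>, which is below \<open>pi / 2\<close>, so the
    cosine is positive.\<close>
  obtain j where j: "real j > \<bar>f x\<bar>" using reals_Archimedean2 by blast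
  have "s j * \<bar>f x\<bar> \<le> 1 / real (Suc j) * real (Suc j)"
    using s(1)[of j] s(2)[of j] j by (intro mult_mono) auto
  then have "\<bar>s j * f x\<bar> \<le> 1" using s(1)[of j] by (simp add: abs_mult)
  then have "cos (s j * f x) > 0" using pi_gt3 by (intro cos_gt_zero_pi) linarith+
  moreover have "Re (\<kappa> (s j *\<^sub>R x)) \<le> 0" using \<kappa>[of j] by (auto simp: K_def)
  moreover have "Re (\<kappa> (s j *\<^sub>R x)) = cos (s j * f x)"
    using f x subspace_scale[OF V x] by (simp add: cont_linear_def linear_map_on_def)
  ultimately show False by simp
qed

section \<open>Functionals on the free space, and its topology over a discrete space\<close>

lemma free_lcs_lcs: "free_lcs X L i \<Longrightarrow> locally_convex_space L"
  by (simp add: free_lcs_def)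

lemma free_lcs_image:
  assumes "free_lcs X L i"
  shows "i ` topspace X \<subseteq> topspace L"
  using assms by (auto simp: free_lcs_def continuous_map_def)

lemma free_lcs_functional:
  assumes "free_lcs X L i" and "continuous_map X euclideanreal h"
  obtains f where "cont_linear L f" "\<And>x. x \<in> topspace X \<Longrightarrow> f (i x) = h x"
  using free_lcs_universal[OF assms(1) lcs_euclideanreal] assms(2)
  unfolding free_extension_property_def cont_linear_def by metis

lemma free_lcs_linear_eq:
  assumes L: "free_lcs X L i" and "linear_map_on (topspace L) g" "linear_map_on (topspace L) h"
    and "\<And>x. x \<in> topspace X \<Longrightarrow> g (i x) = h (i x)" and "v \<in> topspace L"
  shows "g v = h v"
  by (rule linear_map_on_eq_span[OF lcs_subspace[OF free_lcs_lcs[OF L]] assms(2,3) free_lcs_image[OF L]])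
    (use assms(4,5) free_lcs_span[OF L] in auto)

text \<open>The values of \<open>g\<close> on \<open>X\<close> have a continuous linear extension,
  and it agrees with \<open>g\<close> because \<open>X\<close> spans. So continuity of a functional
  is decided on \<open>X\<close>.\<close>

lemma free_lcs_cont_linearI:
  assumes L: "free_lcs X L i" and g: "linear_map_on (topspace L) g"
    and c: "continuous_map X euclideanreal (\<lambda>x. g (i x))"
  shows "cont_linear L g"
proof -
  obtain f where f: "cont_linear L f" "\<And>x. x \<in> topspace X \<Longrightarrow> f (i x) = g (i x)"
    using free_lcs_functional[OF L c] by blast
  have "f v = g v" if "v \<in> topspace L" for v
    by (rule free_lcs_linear_eq[OF L _ g f(2) that]) (use f(1) in \<open>simp add: cont_linear_def\<close>)
  then show ?thesis
    using f(1) g continuous_map_eq[of L euclideanreal f g] by (auto simp: cont_linear_def)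
qed

lemma pointwise_bounded_span:
  assumes lin: "\<And>f. f \<in> \<Phi> \<Longrightarrow> linear_map_on (span S) f"
    and bd: "\<And>b. b \<in> S \<Longrightarrow> \<exists>M. \<forall>f\<in>\<Phi>. \<bar>f b\<bar> \<le> M"
  shows "pointwise_bounded (span S) \<Phi>"
  unfolding pointwise_bounded_def
proof
  fix v assume "v \<in> span S"
  then have "v \<in> span S \<and> (\<exists>M. \<forall>f\<in>\<Phi>. \<bar>f v\<bar> \<le> M)"
  proof (induction rule: span_induct_alt)
    case base
    then show ?case
      using linear_map_on_0[OF subspace_span lin] by (auto intro!: exI[of _ 0] span_zero)
  next
    case (step c x y)
    obtain M where M: "\<And>f. f \<in> \<Phi> \<Longrightarrow> \<bar>f x\<bar> \<le> M" using bd[OF step(1)] by blast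
    obtain M' where M': "\<And>f. f \<in> \<Phi> \<Longrightarrow> \<bar>f y\<bar> \<le> M'" using step by blast
    have x: "x \<in> span S" "c *\<^sub>R x \<in> span S" using step(1) by (auto intro: span_base span_scale)
    have "\<bar>f (c *\<^sub>R x + y)\<bar> \<le> \<bar>c\<bar> * M + M'" if "f \<in> \<Phi>" for f
    proof -
      have "f (c *\<^sub>R x + y) = c * f x + f y"
        using lin[OF that] x step by (simp add: linear_map_on_def)
      moreover have "\<bar>c * f x\<bar> \<le> \<bar>c\<bar> * M" using M[OF that] by (simp add: abs_mult mult_left_mono)
      ultimately show ?thesis using M'[OF that] by linarith
    qed
    then show ?case using x step by (auto intro: span_add)
  qed
  then show "\<exists>M. \<forall>f\<in>\<Phi>. \<bar>f v\<bar> \<le> M" by blast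
qed

lemma linear_map_on_sum:
  assumes "linear_map_on V f" "subspace V" "finite t" "t \<subseteq> V"
  shows "f (\<Sum>b\<in>t. r b *\<^sub>R b) = (\<Sum>b\<in>t. r b *\<^sub>R f b)"
  using assms(3,4)
proof (induction t)
  case empty
  then show ?case using linear_map_on_0[OF assms(2,1)] by simp
next
  case (insert b t)
  have "(\<Sum>b\<in>t. r b *\<^sub>R b) \<in> V" "r b *\<^sub>R b \<in> V"
    using insert assms(2) by (auto intro: subspace_sum subspace_scale)
  then show ?case using insert assms(1) by (simp add: linear_map_on_def)
qed

lemma convex_subsum:
  fixes y :: "'b \<Rightarrow> 'v::real_vector"
  assumes C: "convex C" "0 \<in> C" and t: "finite t" and u: "\<And>b. b \<in> t \<Longrightarrow> u b \<ge> 0" "sum u t \<le> 1"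
    and y: "\<And>b. b \<in> t \<Longrightarrow> y b \<in> C"
  shows "(\<Sum>b\<in>t. u b *\<^sub>R y b) \<in> C"
proof (cases "sum u t = 0")
  case True
  then have "(\<Sum>b\<in>t. u b *\<^sub>R y b) = 0" using sum_nonneg_eq_0_iff[OF t, of u] u(1) by (simp)
  then show ?thesis using C(2) by simp
next
  case False
  then have pos: "sum u t > 0" using sum_nonneg[of t u] u(1) by fastforce
  have "(\<Sum>b\<in>t. (u b / sum u t) *\<^sub>R y b) \<in> C"
    using pos u(1) y by (intro convex_sum[OF t C(1)]) (auto simp flip: sum_divide_distrib)
  then have "(1 - sum u t) *\<^sub>R 0 + sum u t *\<^sub>R (\<Sum>b\<in>t. (u b / sum u t) *\<^sub>R y b) \<in> C"
    using C u(2) pos by (intro convexD) auto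
  moreover have "sum u t *\<^sub>R (\<Sum>b\<in>t. (u b / sum u t) *\<^sub>R y b) = (\<Sum>b\<in>t. u b *\<^sub>R y b)"
    using pos by (simp add: scaleR_sum_right)
  ultimately show ?thesis by simp
qed

text \<open>Into any locally convex topology on the same carrier \<open>i\<close> is continuous,
  since \<open>X\<close> is discrete; its continuous linear extension is the identity.\<close>

lemma free_lcs_discrete_finer:
  assumes L: "free_lcs X L i" and X: "X = discrete_topology (topspace X)"
    and N: "locally_convex_space N" "topspace N = topspace L"
  shows "finer_than L N"
proof -
  have "continuous_map (discrete_topology (topspace X)) N i"
    using free_lcs_image[OF L] N(2) by auto
  then have "continuous_map X N i" using X by metis
  then obtain g where g: "linear_map_on (topspace L) g" "continuous_map L N g"
    "\<And>x. x \<in> topspace X \<Longrightarrow> g (i x) = i x"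
    using free_lcs_universal[OF L N(1)] unfolding free_extension_property_def by metis
  have "g v = v" if "v \<in> topspace L" for v
    by (rule free_lcs_linear_eq[OF L g(1) _ g(3) that]) (simp add: linear_map_on_def)
  then have id: "continuous_map L N (\<lambda>v. v)" using g(2) by (auto intro: continuous_map_eq)
  have "openin L U" if U: "openin N U" for U
  proof -
    have "{v \<in> topspace L. v \<in> U} = U" using openin_subset[OF U] N(2) by auto
    then show ?thesis using openin_continuous_map_preimage[OF id U] by simp
  qed
  then show ?thesis by (simp add: finer_than_def)
qed

text \<open>Inside a convex neighbourhood \<open>C\<close> lies a weighted l1-ball, which is the
  polar of the functionals with \<open>\<bar>f b\<bar> \<le> w b\<close> on the generators. Polars
  are quasi-convex.\<close>

lemma free_lcs_discrete_locally_quasi_convex: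
  assumes L: "free_lcs X L i" and X: "X = discrete_topology (topspace X)"
  shows "locally_quasi_convex L"
proof -
  let ?V = "topspace L"
  note lcs = free_lcs_lcs[OF L]
  note V = lcs_subspace[OF lcs]
  define S where "S = i ` topspace X"
  have SV: "S \<subseteq> ?V" and span: "?V = span S"
    using free_lcs_image[OF L] free_lcs_span[OF L] by (auto simp: S_def)
  have cont: "continuous_map X euclideanreal h" for h :: "'a \<Rightarrow> real"
    by (subst X) simp
  have "neighbourhood_base_at 0 (quasi_convex L) L"
    unfolding neighbourhood_base_at_def
  proof (intro allI impI)
    fix U assume U: "openin L U \<and> 0 \<in> U"
    then obtain W C where C: "openin L W" "convex C" "0 \<in> W" "W \<subseteq> C" "C \<subseteq> U"
      using lcs unfolding locally_convex_space_def neighbourhood_base_at_def by blast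
    have "\<exists>w>0. \<forall>c. \<bar>c\<bar> \<le> 1 / w \<longrightarrow> c *\<^sub>R b \<in> C" if "b \<in> S" for b
    proof -
      have "continuous_map euclideanreal L (\<lambda>t. t *\<^sub>R b)"
        using continuous_map_scaleR[OF lcs, of euclideanreal "\<lambda>t. t" "\<lambda>_. b"] that SV by auto
      from openin_continuous_map_preimage[OF this C(1)]
      have "open {t. t *\<^sub>R b \<in> W}" by simp
      moreover have "0 \<in> {t. t *\<^sub>R b \<in> W}" using C by simp
      ultimately obtain e where e: "e > 0" "ball 0 e \<subseteq> {t. t *\<^sub>R b \<in> W}"
        using open_contains_ball by blast
      have "c *\<^sub>R b \<in> C" if "\<bar>c\<bar> \<le> 1 / (2 / e)" for c
      proof -
        have "c \<in> ball 0 e" using that e(1) by (simp add: dist_real_def)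
        then show ?thesis using e(2) C(4) by auto
      qed
      then show ?thesis using e(1) by (intro exI[of _ "2 / e"]) auto
    qed
    then obtain w where w: "\<And>b. b \<in> S \<Longrightarrow> w b > 0" "\<And>b c. b \<in> S \<Longrightarrow> \<bar>c\<bar> \<le> 1 / w b \<Longrightarrow> c *\<^sub>R b \<in> C"
      by metis
    define \<Phi> where "\<Phi> = {f. linear_map_on ?V f \<and> (\<forall>b\<in>S. \<bar>f b\<bar> \<le> w b)}"
    have lin: "linear_map_on ?V f" if "f \<in> \<Phi>" for f using that by (simp add: \<Phi>_def)
    have cl: "cont_linear L f" if "f \<in> \<Phi>" for f
      using free_lcs_cont_linearI[OF L lin[OF that] cont] .
    have bd: "pointwise_bounded ?V \<Phi>"
      unfolding span by (rule pointwise_bounded_span) (auto simp: \<Phi>_def span)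
    have qc: "quasi_convex L {v \<in> ?V. \<forall>f\<in>\<Phi>. \<bar>f v\<bar> \<le> 1}"
      by (rule quasi_convex_polar[OF V cl]) auto
    have sub: "{v \<in> ?V. \<forall>f\<in>\<Phi>. \<bar>f v\<bar> \<le> 1} \<subseteq> C"
    proof
      fix v assume v: "v \<in> {v \<in> ?V. \<forall>f\<in>\<Phi>. \<bar>f v\<bar> \<le> 1}"
      then obtain t r where t: "finite t" "t \<subseteq> S" "v = (\<Sum>b\<in>t. r b *\<^sub>R b)"
        using span by (auto simp: span_explicit)
      \<comment> \<open>The extremal functional for \<open>v\<close>: it turns
        \<open>\<bar>f v\<bar> \<le> 1\<close> into a bound for the weighted sum of the
        \<open>\<bar>r b\<bar>\<close>.\<close>
      obtain f where f: "cont_linear L f" "\<And>x. x \<in> topspace X \<Longrightarrow> f (i x) = sgn (r (i x)) * w (i x)"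
        using free_lcs_functional[OF L cont, of "\<lambda>x. sgn (r (i x)) * w (i x)"] by blast
      have fb: "f b = sgn (r b) * w b" if "b \<in> S" for b using that f(2) by (auto simp: S_def)
      have "f \<in> \<Phi>"
        using f(1) fb w(1) by (auto simp: \<Phi>_def cont_linear_def abs_mult sgn_if less_imp_le)
      then have "\<bar>f v\<bar> \<le> 1" using v by blast
      moreover have "f v = (\<Sum>b\<in>t. r b *\<^sub>R f b)"
        unfolding t(3) using t SV f(1) by (intro linear_map_on_sum[OF _ V]) (auto simp: cont_linear_def)
      moreover have "\<dots> = (\<Sum>b\<in>t. \<bar>r b\<bar> * w b)"
      proof (rule sum.cong)
        show "r b *\<^sub>R f b = \<bar>r b\<bar> * w b" if "b \<in> t" for b
          using fb[of b] that t(2) by (auto simp: sgn_if)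
      qed simp
      ultimately have "(\<Sum>b\<in>t. \<bar>r b\<bar> * w b) \<le> 1" by simp
      \<comment> \<open>This is \<open>v\<close> as a subconvex combination: the weights
        \<open>\<bar>r b\<bar> * w b\<close> have sum at most \<open>1\<close>, and the signs go
        into the points, which lie in \<open>C\<close> by the choice of \<open>w\<close>.\<close>
      then have "(\<Sum>b\<in>t. (\<bar>r b\<bar> * w b) *\<^sub>R ((sgn (r b) / w b) *\<^sub>R b)) \<in> C"
      proof (intro convex_subsum[OF C(2)])
        fix b assume "b \<in> t"
        then have b: "b \<in> S" using t(2) by auto
        show "\<bar>r b\<bar> * w b \<ge> 0" using w(1)[OF b] by simp
        show "(sgn (r b) / w b) *\<^sub>R b \<in> C" using w(1)[OF b] by (intro w(2)[OF b]) (auto simp: sgn_if)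
      qed (use t C in auto)
      moreover have "(\<Sum>b\<in>t. (\<bar>r b\<bar> * w b) *\<^sub>R ((sgn (r b) / w b) *\<^sub>R b)) = v"
        unfolding t(3)
      proof (rule sum.cong)
        show "(\<bar>r b\<bar> * w b) *\<^sub>R ((sgn (r b) / w b) *\<^sub>R b) = r b *\<^sub>R b" if "b \<in> t" for b
          using w(1)[of b] that t(2) by (auto simp: sgn_if)
      qed simp
      ultimately show "v \<in> C" by simp
    qed
    let ?O = "{v \<in> ?V. \<exists>d<1. \<forall>f\<in>\<Phi>. \<bar>f (v - 0)\<bar> \<le> d}"
    have 0: "0 \<in> ?V" using V by (rule subspace_0)
    \<comment> \<open>\<open>L\<close> is finer than every locally convex topology on its carrier,
      so even its own refinement by \<open>\<Phi>\<close> adds nothing and the polar is a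
      neighbourhood.\<close>
    have "finer_than L (refine L \<Phi>)"
      by (rule free_lcs_discrete_finer[OF L X lcs_refine[OF lcs lin bd]]) auto
    then have "openin L ?O"
      using openin_refine_small[OF V lin 0] unfolding finer_than_def by blast
    moreover have "0 \<in> ?O" using 0 linear_map_on_0[OF V lin] by (auto intro!: exI[of _ 0])
    moreover have "?O \<subseteq> {v \<in> ?V. \<forall>f\<in>\<Phi>. \<bar>f v\<bar> \<le> 1}" by force
    ultimately show "\<exists>O' A. openin L O' \<and> quasi_convex L A \<and> 0 \<in> O' \<and> O' \<subseteq> A \<and> A \<subseteq> U"
      using qc sub C(5) by (intro exI[of _ ?O] exI[of _ "{v \<in> ?V. \<forall>f\<in>\<Phi>. \<bar>f v\<bar> \<le> 1}"] conjI) auto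
  qed
  then show ?thesis
    unfolding locally_quasi_convex_def using lcs_abelian_topological_group[OF lcs] by blast
qed

lemma free_lcs_discrete_mackey_space:
  assumes "free_lcs X L i" and "X = discrete_topology (topspace X)"
  shows "mackey_space L"
  using free_lcs_lcs[OF assms(1)] free_lcs_discrete_finer[OF assms]
  by (auto simp: mackey_space_def is_mackey_topology_def lcs_compatible_def)

lemma free_lcs_discrete_mackey_group:
  assumes L: "free_lcs X L i" and X: "X = discrete_topology (topspace X)"
  shows "mackey_group L"
  unfolding mackey_group_def
proof (intro conjI allI impI)
  show "locally_quasi_convex L" by (rule free_lcs_discrete_locally_quasi_convex[OF assms])
  fix N assume N: "locally_quasi_convex N \<and> topspace N = topspace L \<and> characters N = characters L"
  let ?V = "topspace L"
  note lcs = free_lcs_lcs[OF L]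
  note V = lcs_subspace[OF lcs]
  have grp: "abelian_topological_group N" using N by (simp add: locally_quasi_convex_def)
  show "finer_than L N"
  proof (rule finer_thanI_zero[OF lcs_abelian_topological_group[OF lcs] grp])
    show "topspace N = topspace L" using N by simp
    fix U assume U: "openin N U" "0 \<in> U"
    then obtain W A where A: "openin N W" "quasi_convex N A" "0 \<in> W" "W \<subseteq> A" "A \<subseteq> U"
      using N unfolding locally_quasi_convex_def neighbourhood_base_at_def by blast
    define \<Phi> where "\<Phi> = {f. cont_linear L f \<and> (\<forall>v\<in>A. cos (f v) \<ge> 0)}"
    have lin: "linear_map_on ?V f" if "f \<in> \<Phi>" for f using that by (simp add: \<Phi>_def cont_linear_def)
    have "pointwise_bounded ?V {f. cont_linear L f \<and> (\<forall>v\<in>W. cos (f v) \<ge> 0)}"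
      by (rule pointwise_bounded_if_characters_subset[OF lcs grp _ _ A(1,3)]) (use N in auto)
    then have bd: "pointwise_bounded ?V \<Phi>"
      using A(4) unfolding pointwise_bounded_def \<Phi>_def by blast
    let ?O = "{v \<in> ?V. \<exists>d<pi/2. \<forall>f\<in>\<Phi>. \<bar>f (v - 0)\<bar> \<le> d}"
    have 0: "0 \<in> ?V" using V by (rule subspace_0)
    have "finer_than L (refine L \<Phi>)"
      by (rule free_lcs_discrete_finer[OF L X lcs_refine[OF lcs lin bd]]) auto
    then have "openin L ?O"
      using openin_refine_small[OF V lin 0] unfolding finer_than_def by blast
    moreover have "0 \<in> ?O" using 0 linear_map_on_0[OF V lin] pi_gt_zero by (auto intro!: exI[of _ 0])
    \<comment> \<open>A character separating \<open>v\<close> from \<open>A\<close> would lift to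
      some \<open>f\<close> in \<open>\<Phi>\<close>, but then
      \<open>\<bar>f v\<bar> < pi / 2\<close> puts its value at \<open>v\<close> into the right half
      circle.\<close>
    moreover have "v \<in> A" if v: "v \<in> ?O" for v
    proof (rule ccontr)
      assume "v \<notin> A"
      then obtain \<kappa> where \<kappa>: "\<kappa> \<in> characters N" "\<kappa> v \<notin> right_half_circle" "\<kappa> ` A \<subseteq> right_half_circle"
        using A(2) v N unfolding quasi_convex_def by blast
      then obtain f where f: "cont_linear L f" "\<kappa> = restrict (\<lambda>v. cis (f v)) ?V"
        using N character_lift[OF lcs] by metis
      have "A \<subseteq> ?V" using A(2) N by (simp add: quasi_convex_def)
      then have "f \<in> \<Phi>" using f \<kappa>(3) by (auto simp: \<Phi>_def right_half_circle_def image_subset_iff)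
      then have "\<bar>f v\<bar> \<le> pi / 2" using v by fastforce
      then have "cos (f v) \<ge> 0" by (intro cos_ge_zero) auto
      then show False using \<kappa>(2) f(2) v by (simp add: right_half_circle_def)
    qed
    ultimately show "\<exists>W. openin L W \<and> 0 \<in> W \<and> W \<subseteq> U" using A(5) by (intro exI[of _ ?O] conjI) auto
  qed
qed

section \<open>Nondiscrete spaces\<close>

lemma cont_linear_refine:
  assumes "cont_linear T f"
  shows "cont_linear (refine T \<Phi>) f"
  using assms openin_refineI[of T] by (auto simp: cont_linear_def continuous_map_def)

text \<open>A maximal family of functions vanishing at \<open>x0\<close> with disjoint cozero sets has a dense union of
  cozero sets. Composing its members with the bumps \<open>t \<mapsto> max 0 (2 - |2 n t - 3|)\<close> gives
  a point-finite family that is not equicontinuous at \<open>x0\<close>.\<close>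

lemma nonisolated_point_bumps:
  assumes reg: "completely_regular_space X" and haus: "Hausdorff_space X"
    and x0: "x0 \<in> topspace X" and non: "\<not> openin X {x0}"
  obtains F :: "('a \<Rightarrow> real) set"
  where "\<And>f. f \<in> F \<Longrightarrow> continuous_map X euclideanreal f" "\<And>f. f \<in> F \<Longrightarrow> f x0 = 0"
    "\<And>f x. f \<in> F \<Longrightarrow> 0 \<le> f x \<and> f x \<le> 2"
    "\<And>x. x \<in> topspace X \<Longrightarrow> finite {f \<in> F. f x \<noteq> 0}"
    "\<And>W. openin X W \<Longrightarrow> x0 \<in> W \<Longrightarrow> \<exists>x\<in>W. \<exists>f\<in>F. f x \<ge> 1"
proof -
  define D where "D = {g :: 'a \<Rightarrow> real. continuous_map X euclideanreal g \<and> g x0 = 0 \<and>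
      (\<forall>x\<in>topspace X. 0 \<le> g x \<and> g x \<le> 1)}"
  define \<A> where "\<A> = {G. G \<subseteq> D \<and> (\<forall>g\<in>G. \<forall>h\<in>G. g \<noteq> h \<longrightarrow> (\<forall>x\<in>topspace X. g x = 0 \<or> h x = 0))}"
  have "\<exists>G\<in>\<A>. \<forall>H\<in>\<A>. G \<subseteq> H \<longrightarrow> H = G"
  proof (rule subset_Zorn')
    fix \<C> assume C: "subset.chain \<A> \<C>"
    show "\<Union>\<C> \<in> \<A>"
      unfolding \<A>_def
    proof (intro CollectI conjI ballI impI)
      show "\<Union>\<C> \<subseteq> D" using C by (auto simp: subset.chain_def \<A>_def)
      fix g h x assume gh: "g \<in> \<Union>\<C>" "h \<in> \<Union>\<C>" "g \<noteq> h" and x: "x \<in> topspace X"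
      then obtain G H where GH: "G \<in> \<C>" "H \<in> \<C>" "g \<in> G" "h \<in> H" by auto
      then have "G \<union> H \<in> \<A>" "g \<in> G \<union> H" "h \<in> G \<union> H"
        using C unfolding subset_chain_def by (metis Un_absorb1 Un_absorb2 subsetD, auto)
      then show "g x = 0 \<or> h x = 0" using gh(3) x unfolding \<A>_def by blast
    qed
  qed
  then obtain G where G: "G \<in> \<A>" and max: "\<And>H. H \<in> \<A> \<Longrightarrow> G \<subseteq> H \<Longrightarrow> H = G" by blast
  have GD: "G \<subseteq> D" and disj: "\<And>g h x. g \<in> G \<Longrightarrow> h \<in> G \<Longrightarrow> x \<in> topspace X \<Longrightarrow> g x \<noteq> 0 \<Longrightarrow> h x \<noteq> 0 \<Longrightarrow> g = h"
    using G unfolding \<A>_def by blast+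
  \<comment> \<open>If all members of \<open>G\<close> vanished on \<open>W\<close>, complete
    regularity would give a function at home in \<open>W - {x0}\<close>, a set that is open since
    points are closed and nonempty since \<open>x0\<close> is not isolated. It could be added to
    \<open>G\<close>, against maximality.\<close>
  have dense: "\<exists>x\<in>W. \<exists>g\<in>G. g x \<noteq> 0" if W: "openin X W" "x0 \<in> W" for W
  proof (rule ccontr)
    assume "\<not> ?thesis"
    then have zero: "g x = 0" if "g \<in> G" "x \<in> W" for g x using that by blast
    have "W \<noteq> {x0}" using W non by auto
    then obtain y where y: "y \<in> W - {x0}" using W(2) by auto
    have "closedin X {x0}" using haus x0 by (simp add: closedin_Hausdorff_singleton)
    then have "openin X (W - {x0})" using W(1) by (rule openin_diff[rotated])
    then have "closedin X (topspace X - (W - {x0}))" by blast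
    moreover have "y \<in> topspace X - (topspace X - (W - {x0}))"
      using y openin_subset[OF W(1)] by auto
    ultimately obtain f :: "'a \<Rightarrow> real" where f: "continuous_map X (top_of_set {0..1}) f" "f y = 0"
      "f ` (topspace X - (W - {x0})) \<subseteq> {1}"
      using reg unfolding completely_regular_space_def by meson
    define h where "h x = 1 - f x" for x
    have f1: "f x = 1" if "x \<in> topspace X" "x \<notin> W \<or> x = x0" for x using f(3) that by auto
    have "continuous_map X euclideanreal f" "\<And>x. x \<in> topspace X \<Longrightarrow> f x \<in> {0..1}"
      using f(1) by (auto simp: continuous_map_in_subtopology)
    then have "h \<in> D"
      unfolding D_def h_def using f1 x0 by (auto intro!: continuous_map_diff)
    moreover have "g x = 0 \<or> h x = 0" if "g \<in> G" "x \<in> topspace X" for g x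
      using zero[OF that(1), of x] f1[OF that(2)] by (auto simp: h_def)
    ultimately have "insert h G \<in> \<A>" using G unfolding \<A>_def by blast
    then have "h \<in> G" using max[of "insert h G"] by blast
    then have "h y = 0" using zero y by blast
    then show False using f(2) by (simp add: h_def)
  qed
  \<comment> \<open>The tent vanishes outside the interval from \<open>1/2\<close> to
    \<open>5/2\<close> and is at least \<open>1\<close> on \<open>{1..2}\<close>. For
    \<open>0 < g x \<le> 1\<close> some multiple \<open>real n * g x\<close> lies in
    \<open>{1..2}\<close>, while only finitely many stay below \<open>5/2\<close>.\<close>
  define \<psi> :: "real \<Rightarrow> real" where "\<psi> s = max 0 (2 - \<bar>2 * s - 3\<bar>)" for s
  define F where "F = {f. \<exists>n g. g \<in> G \<and> f = (\<lambda>x. \<psi> (real n * g x))}"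
  show thesis
  proof (rule that[of F])
    fix f assume "f \<in> F"
    then obtain n g where f: "g \<in> G" "f = (\<lambda>x. \<psi> (real n * g x))" by (auto simp: F_def)
    have g: "continuous_map X euclideanreal g" "g x0 = 0" using f(1) GD by (auto simp: D_def)
    have "continuous_on UNIV (\<lambda>t. \<psi> (real n * t))" unfolding \<psi>_def by (intro continuous_intros)
    then show "continuous_map X euclideanreal f"
      using continuous_map_compose[OF g(1), of euclideanreal "\<lambda>t. \<psi> (real n * t)"] f(2) by (simp add: o_def)
    show "f x0 = 0" using f(2) g(2) by (simp add: \<psi>_def)
    show "0 \<le> f x \<and> f x \<le> 2" for x using f(2) by (simp add: \<psi>_def)
  next
    fix x assume x: "x \<in> topspace X"
    let ?Gx = "{g \<in> G. g x \<noteq> 0}"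
    have "finite {n. real n * g x < 5 / 2}" if g: "g \<in> ?Gx" for g
    proof -
      have "g \<in> D" "g x \<noteq> 0" using g GD by auto
      then have pos: "g x > 0" using x by (simp add: D_def order_less_le)
      have "n \<le> nat \<lceil>5 / 2 / g x\<rceil>" if "real n * g x < 5 / 2" for n
      proof -
        have "real n < 5 / 2 / g x" using that pos by (simp only: pos_less_divide_eq)
        then show ?thesis by linarith
      qed
      then have "{n. real n * g x < 5 / 2} \<subseteq> {..nat \<lceil>5 / 2 / g x\<rceil>}" by blast
      then show ?thesis by (rule finite_subset) simp
    qed
    moreover have "finite ?Gx"
    proof (cases "?Gx = {}")
      case False
      then obtain g where "g \<in> ?Gx" by blast
      then have "?Gx \<subseteq> {g}" using disj x by blast
      then show ?thesis using finite_subset by blast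
    qed (simp only: finite.emptyI)
    ultimately have "finite (\<Union>g\<in>?Gx. (\<lambda>n x. \<psi> (real n * g x)) ` {n. real n * g x < 5 / 2})"
      by blast
    moreover have "{f \<in> F. f x \<noteq> 0} \<subseteq> (\<Union>g\<in>?Gx. (\<lambda>n x. \<psi> (real n * g x)) ` {n. real n * g x < 5 / 2})"
    proof
      fix f assume "f \<in> {f \<in> F. f x \<noteq> 0}"
      then obtain n g where f: "g \<in> G" "f = (\<lambda>x. \<psi> (real n * g x))" "\<psi> (real n * g x) \<noteq> 0"
        by (auto simp: F_def)
      then have "real n * g x < 5 / 2" "g x \<noteq> 0" by (auto simp: \<psi>_def max_def abs_if split: if_splits)
      then show "f \<in> (\<Union>g\<in>?Gx. (\<lambda>n x. \<psi> (real n * g x)) ` {n. real n * g x < 5 / 2})"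
        using f by blast
    qed
    ultimately show "finite {f \<in> F. f x \<noteq> 0}" by (rule finite_subset[rotated])
  next
    fix W assume W: "openin X W" "x0 \<in> W"
    obtain x g where x: "x \<in> W" "g \<in> G" "g x \<noteq> 0" using dense[OF W] by blast
    then have "g \<in> D" "x \<in> topspace X" using GD openin_subset[OF W(1)] by auto
    then have gx: "0 < g x" "g x \<le> 1" using x(3) by (auto simp: D_def order_less_le)
    define n where "n = nat \<lceil>1 / g x\<rceil>"
    have "1 / g x \<le> real n" "real n < 1 / g x + 1" using gx by (auto simp: n_def) linarith
    then have "1 \<le> real n * g x" "real n * g x < (1 / g x + 1) * g x"
      using gx by (auto simp: pos_divide_le_eq)
    moreover have "(1 / g x + 1) * g x = 1 + g x" using gx by (simp add: distrib_right)
    ultimately have "1 \<le> \<psi> (real n * g x)" using gx by (simp add: \<psi>_def)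
    then show "\<exists>x\<in>W. \<exists>f\<in>F. f x \<ge> 1" using x by (auto simp: F_def)
  qed
qed

lemma finite_support_span:
  assumes lin: "\<And>f. f \<in> \<Phi> \<Longrightarrow> linear_map_on (span S) f"
    and fin: "\<And>b. b \<in> S \<Longrightarrow> finite {f \<in> \<Phi>. f b \<noteq> (0::real)}" and v: "v \<in> span S"
  shows "finite {f \<in> \<Phi>. f v \<noteq> 0}"
proof -
  have "v \<in> span S \<and> finite {f \<in> \<Phi>. f v \<noteq> 0}"
    using v
  proof (induction rule: span_induct_alt)
    case base
    have "{f \<in> \<Phi>. f 0 \<noteq> 0} = {}" using linear_map_on_0[OF subspace_span lin] by auto
    then show ?case by (simp only: span_zero finite.emptyI)
  next
    case (step c x y)
    have x: "x \<in> span S" "c *\<^sub>R x \<in> span S" using step(1) by (auto intro: span_base span_scale)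
    have eq: "f (c *\<^sub>R x + y) = c * f x + f y" if "f \<in> \<Phi>" for f
      using lin[OF that] x step by (simp add: linear_map_on_def)
    have "{f \<in> \<Phi>. f (c *\<^sub>R x + y) \<noteq> 0} \<subseteq> {f \<in> \<Phi>. f x \<noteq> 0} \<union> {f \<in> \<Phi>. f y \<noteq> 0}"
    proof
      fix f assume "f \<in> {f \<in> \<Phi>. f (c *\<^sub>R x + y) \<noteq> 0}"
      then show "f \<in> {f \<in> \<Phi>. f x \<noteq> 0} \<union> {f \<in> \<Phi>. f y \<noteq> 0}" using eq[of f] by auto
    qed
    then have "finite {f \<in> \<Phi>. f (c *\<^sub>R x + y) \<noteq> 0}"
      using fin[OF step(1)] step by (meson finite_UnI finite_subset)
    then show ?case using x step by (auto intro: span_add)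
  qed
  then show ?thesis by blast
qed

text \<open>Gliding hump: otherwise vectors with \<open>sup |f v| \<le> 1\<close> and \<open>g v > e\<close> whose supports in \<open>\<Phi>\<close> are almost
  disjoint could be added up, and \<open>g\<close> would be unbounded on \<open>sup |f v| \<le> 2\<close>.\<close>

lemma refine_functional_small:
  assumes T: "locally_convex_space T" and \<Phi>: "\<And>f. f \<in> \<Phi> \<Longrightarrow> cont_linear T f"
    and fin: "\<And>v. v \<in> topspace T \<Longrightarrow> finite {f \<in> \<Phi>. f v \<noteq> 0}"
    and g: "cont_linear (refine T \<Phi>) g" and e: "e > 0"
  obtains W where "openin T W" "0 \<in> W" "\<And>v. v \<in> W \<Longrightarrow> (\<And>f. f \<in> \<Phi> \<Longrightarrow> \<bar>f v\<bar> \<le> 1) \<Longrightarrow> \<bar>g v\<bar> \<le> e"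
proof (rule ccontr)
  let ?V = "topspace T"
  note V = lcs_subspace[OF T]
  have 0: "0 \<in> ?V" using V by (rule subspace_0)
  have lin: "linear_map_on ?V f" if "f \<in> \<Phi>" for f using \<Phi>[OF that] by (simp add: cont_linear_def)
  have glin: "linear_map_on ?V g" using g by (simp add: cont_linear_def)
  note witness = that
  assume no: "\<not> thesis"
  have hump: "\<exists>v\<in>W. (\<forall>f\<in>\<Phi>. \<bar>f v\<bar> \<le> 1) \<and> g v \<ge> e" if W: "openin T W" "0 \<in> W" for W
  proof -
    \<comment> \<open>A neighbourhood symmetric about \<open>0\<close> allows \<open>v\<close> to be
      replaced by its negative, so the humps of \<open>g\<close> are all positive and add
      up.\<close>
    let ?W = "W \<inter> {v \<in> ?V. (-1) *\<^sub>R v \<in> W}"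
    have "openin T ?W" "0 \<in> ?W" using W 0 openin_scaleR[OF T W(1), of "-1"] by auto
    then have "\<exists>v\<in>?W. (\<forall>f\<in>\<Phi>. \<bar>f v\<bar> \<le> 1) \<and> \<bar>g v\<bar> > e" using no witness[of ?W] by force
    then obtain v where v: "v \<in> ?W" "\<forall>f\<in>\<Phi>. \<bar>f v\<bar> \<le> 1" "\<bar>g v\<bar> > e" by blast
    have neg: "h ((-1) *\<^sub>R v) = - h v" if "linear_map_on ?V h" for h :: "'a \<Rightarrow> real"
      using linear_map_on_scale[OF that, of v "-1"] v(1) by simp
    show ?thesis
    proof (cases "g v \<ge> 0")
      case True
      then show ?thesis using v by (intro bexI[of _ v]) auto
    next
      case False
      have "\<bar>f ((-1) *\<^sub>R v)\<bar> \<le> 1" if "f \<in> \<Phi>" for f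
        unfolding neg[OF lin[OF that]] using v(2) that by simp
      moreover have "g ((-1) *\<^sub>R v) \<ge> e" unfolding neg[OF glin] using False v(3) by simp
      ultimately show ?thesis using v(1) by blast
    qed
  qed
  \<comment> \<open>The bound must stay strictly below \<open>2\<close>, because the slack
    \<open>2 - d\<close> has to accommodate the next hump.\<close>
  have big: "\<exists>v\<in>W. (\<exists>d<2. \<forall>f\<in>\<Phi>. \<bar>f v\<bar> \<le> d) \<and> g v \<ge> real m * e" if "openin T W" "0 \<in> W" for m W
    using that
  proof (induction m)
    case 0
    have "\<forall>f\<in>\<Phi>. \<bar>f 0\<bar> \<le> 0" using linear_map_on_0[OF V lin] by simp
    then have "\<exists>d<2. \<forall>f\<in>\<Phi>. \<bar>f 0\<bar> \<le> d" by (intro exI[of _ 0] conjI) auto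
    then show ?case using 0 linear_map_on_0[OF V glin] by (intro bexI[of _ 0]) simp_all
  next
    case (Suc m)
    then obtain v d where v: "v \<in> W" "d < 2" "\<forall>f\<in>\<Phi>. \<bar>f v\<bar> \<le> d" "g v \<ge> real m * e" by blast
    have vV: "v \<in> ?V" using v(1) openin_subset[OF Suc.prems(1)] by blast
    let ?\<Psi> = "{f \<in> \<Phi>. f v \<noteq> 0}"
    define \<epsilon> where "\<epsilon> = (2 - d) / 2"
    have \<epsilon>: "\<epsilon> > 0" using v(2) by (simp add: \<epsilon>_def)
    \<comment> \<open>The next hump \<open>w\<close> is small at the finitely many functionals that
      see \<open>v\<close>; the others see only \<open>w\<close>, where they are at most
      \<open>1\<close>. The last factor keeps the sum in \<open>W\<close>.\<close>
    let ?Z = "((\<Inter>f\<in>?\<Psi>. {w \<in> ?V. \<bar>f w\<bar> < \<epsilon>}) \<inter> ?V) \<inter> {w \<in> ?V. v + w \<in> W}"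
    have "openin T ?Z"
      by (intro openin_Int openin_INT[OF fin[OF vV]] cont_linear_small(1)[OF \<Phi> T \<epsilon>]
          openin_translate[OF lcs_abelian_topological_group[OF T] Suc.prems(1) vV]) auto
    moreover have "0 \<in> ?Z" using cont_linear_small(2)[OF \<Phi> T \<epsilon>] 0 v(1) by auto
    ultimately have "\<exists>w\<in>?Z. (\<forall>f\<in>\<Phi>. \<bar>f w\<bar> \<le> 1) \<and> g w \<ge> e" by (rule hump)
    then obtain w where w: "w \<in> ?Z" "\<forall>f\<in>\<Phi>. \<bar>f w\<bar> \<le> 1" "g w \<ge> e" by (elim bexE conjE)
    have wV: "w \<in> ?V" using w(1) by auto
    have "\<bar>f (v + w)\<bar> \<le> max 1 (d + \<epsilon>)" if f: "f \<in> \<Phi>" for f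
    proof (cases "f v = 0")
      case True
      then show ?thesis using linear_map_on_add[OF lin[OF f] vV wV] w(2) f by fastforce
    next
      case False
      then have "\<bar>f w\<bar> < \<epsilon>" using w(1) f by auto
      moreover have "\<bar>f v\<bar> \<le> d" using v(3) f by blast
      ultimately show ?thesis using linear_map_on_add[OF lin[OF f] vV wV] by linarith
    qed
    moreover have "max 1 (d + \<epsilon>) < 2" using v(2) by (simp add: \<epsilon>_def field_simps)
    moreover have "g (v + w) \<ge> real (Suc m) * e"
      using linear_map_on_add[OF glin vV wV] v(4) w(3) by (simp add: algebra_simps)
    moreover have "v + w \<in> W" using w(1) by auto
    ultimately show ?case by blast
  qed
  have "openin (refine T \<Phi>) {v \<in> ?V. g v \<in> ball 0 1}"
    using g openin_continuous_map_preimage[of "refine T \<Phi>" euclideanreal g "ball 0 1"]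
    by (simp add: cont_linear_def)
  moreover have "0 \<in> {v \<in> ?V. g v \<in> ball 0 1}" using 0 linear_map_on_0[OF V glin] by simp
  ultimately obtain W c where W: "openin T W" "0 \<in> W" "c > 0"
    "{y \<in> W. \<forall>f\<in>\<Phi>. \<bar>f (y - 0)\<bar> \<le> c} \<subseteq> {v \<in> ?V. g v \<in> ball 0 1}"
    unfolding openin_refine by blast
  \<comment> \<open>Scaling by \<open>c / 2\<close> takes the seminorm bound \<open>2\<close> to
    \<open>c\<close>, where \<open>\<bar>g\<bar> < 1\<close>; so \<open>g v < 2 / c\<close>, which
    this \<open>m\<close> contradicts.\<close>
  obtain m where m: "real m * e > 2 / c" using reals_Archimedean3[OF e] by blast
  let ?W = "{v \<in> ?V. (c / 2) *\<^sub>R v \<in> W}"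
  have "openin T ?W" "0 \<in> ?W" using openin_scaleR[OF T W(1)] W(2) 0 by auto
  from big[OF this, of m] obtain v d where v: "v \<in> ?W" "d < 2" "\<forall>f\<in>\<Phi>. \<bar>f v\<bar> \<le> d" "g v \<ge> real m * e"
    by blast
  have "\<bar>f ((c / 2) *\<^sub>R v)\<bar> \<le> c" if f: "f \<in> \<Phi>" for f
  proof -
    have "\<bar>f v\<bar> \<le> 2" using v(2,3) f by force
    then have "c / 2 * \<bar>f v\<bar> \<le> c / 2 * 2" using W(3) by (intro mult_left_mono) auto
    moreover have "f ((c / 2) *\<^sub>R v) = c / 2 * f v"
      using linear_map_on_scale[OF lin[OF f], of v "c / 2"] v(1) by simp
    moreover have "\<bar>c / 2 * f v\<bar> = c / 2 * \<bar>f v\<bar>" using W(3) by (simp add: abs_mult)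
    ultimately show ?thesis by simp
  qed
  then have "(c / 2) *\<^sub>R v \<in> {y \<in> W. \<forall>f\<in>\<Phi>. \<bar>f (y - 0)\<bar> \<le> c}" using v(1) by simp
  then have "\<bar>g ((c / 2) *\<^sub>R v)\<bar> < 1" using W(4) by (auto simp: dist_real_def)
  then have "c / 2 * g v < 1" using linear_map_on_scale[OF glin, of v "c / 2"] v(1) by simp
  then have "g v < 2 / c" using W(3) by (simp add: field_simps)
  then show False using m v(4) by simp
qed

text \<open>Continuity of \<open>g\<close> has to be checked on \<open>X\<close> only. Members of
  \<open>\<Phi>\<close> take values between \<open>0\<close> and \<open>2\<close> there, so half of
  a difference \<open>i x - i y\<close> has seminorm at most \<open>1\<close> and
  \<open>refine_functional_small\<close> applies to it.\<close>

lemma free_lcs_refine_functional: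
  assumes L: "free_lcs X L i" and \<Phi>: "\<And>f. f \<in> \<Phi> \<Longrightarrow> cont_linear L f"
    and fin: "\<And>x. x \<in> topspace X \<Longrightarrow> finite {f \<in> \<Phi>. f (i x) \<noteq> 0}"
    and bd: "\<And>f x. f \<in> \<Phi> \<Longrightarrow> x \<in> topspace X \<Longrightarrow> 0 \<le> f (i x) \<and> f (i x) \<le> 2"
    and g: "cont_linear (refine L \<Phi>) g"
  shows "cont_linear L g"
proof (rule free_lcs_cont_linearI[OF L])
  let ?V = "topspace L"
  note lcs = free_lcs_lcs[OF L]
  note V = lcs_subspace[OF lcs]
  have lin: "linear_map_on ?V f" if "f \<in> \<Phi>" for f using \<Phi>[OF that] by (simp add: cont_linear_def)
  show glin: "linear_map_on ?V g" using g by (simp add: cont_linear_def)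
  have ix: "i x \<in> ?V" if "x \<in> topspace X" for x using free_lcs_image[OF L] that by auto
  have finV: "finite {f \<in> \<Phi>. f v \<noteq> 0}" if "v \<in> ?V" for v
    by (rule finite_support_span[where S = "i ` topspace X"])
      (use lin fin that free_lcs_span[OF L] in auto)
  have half: "f ((1/2) *\<^sub>R (i x + - i y)) = (f (i x) - f (i y)) / 2"
    if "linear_map_on ?V f" "x \<in> topspace X" "y \<in> topspace X" for f :: "'b \<Rightarrow> real" and x y
    using linear_map_on_scale[OF that(1), of "i x - i y" "1/2"] linear_map_on_diff[OF that(1) V]
      ix[OF that(2)] ix[OF that(3)] subspace_diff[OF V] by simp
  show "continuous_map X euclideanreal (\<lambda>x. g (i x))"
    unfolding continuous_map_def
  proof (intro conjI allI impI)
    fix S :: "real set" assume "openin euclideanreal S"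
    then have S: "open S" by simp
    show "openin X {x \<in> topspace X. g (i x) \<in> S}"
    proof (subst openin_subopen, intro ballI)
      fix y assume y: "y \<in> {x \<in> topspace X. g (i x) \<in> S}"
      then obtain e where e: "e > 0" "ball (g (i y)) e \<subseteq> S" using S open_contains_ball by blast
      obtain W where W: "openin L W" "0 \<in> W"
        "\<And>v. v \<in> W \<Longrightarrow> (\<And>f. f \<in> \<Phi> \<Longrightarrow> \<bar>f v\<bar> \<le> 1) \<Longrightarrow> \<bar>g v\<bar> \<le> e / 4"
        using refine_functional_small[OF lcs \<Phi> finV g, of "e / 4"] e(1) by auto
      have ci: "continuous_map X L i" using L by (simp add: free_lcs_def)
      have "- i y \<in> ?V" using ix y subspace_neg[OF V] by blast
      then have "continuous_map X L (\<lambda>x. (1/2) *\<^sub>R (i x + - i y))"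
        by (intro continuous_map_scaleR[OF lcs] continuous_map_add lcs_abelian_topological_group lcs ci) auto
      from openin_continuous_map_preimage[OF this W(1)]
      have "openin X {x \<in> topspace X. (1/2) *\<^sub>R (i x + - i y) \<in> W}" .
      moreover have "g (i x) \<in> S" if x: "x \<in> topspace X" "(1/2) *\<^sub>R (i x + - i y) \<in> W" for x
      proof -
        have "\<bar>f ((1/2) *\<^sub>R (i x + - i y))\<bar> \<le> 1" if "f \<in> \<Phi>" for f
          using half[OF lin[OF that] x(1), of y] bd[OF that x(1)] bd[OF that, of y] y by auto
        then have "\<bar>g ((1/2) *\<^sub>R (i x + - i y))\<bar> \<le> e / 4" using W(3)[OF x(2)] by blast
        then have "\<bar>g (i x) - g (i y)\<bar> < e" using half[OF glin x(1), of y] y e(1) by auto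
        then show ?thesis using e(2) by (auto simp: dist_real_def)
      qed
      ultimately show "\<exists>W. openin X W \<and> y \<in> W \<and> W \<subseteq> {x \<in> topspace X. g (i x) \<in> S}"
        using y W(2) by (intro exI[of _ "{x \<in> topspace X. (1/2) *\<^sub>R (i x + - i y) \<in> W}"]) auto
    qed
  qed auto
qed

lemma free_lcs_nondiscrete_refinement:
  fixes X :: "'a topology" and L :: "'v::real_vector topology"
  assumes reg: "completely_regular_space X" "Hausdorff_space X" and L: "free_lcs X L i"
    and nd: "X \<noteq> discrete_topology (topspace X)"
  obtains \<Phi> where "\<And>f. f \<in> \<Phi> \<Longrightarrow> cont_linear L f" "pointwise_bounded (topspace L) \<Phi>"
    "\<And>g. cont_linear (refine L \<Phi>) g \<longleftrightarrow> cont_linear L g" "\<not> finer_than L (refine L \<Phi>)"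
proof -
  let ?V = "topspace L"
  note lcs = free_lcs_lcs[OF L]
  note V = lcs_subspace[OF lcs]
  have ix: "i x \<in> ?V" if "x \<in> topspace X" for x using free_lcs_image[OF L] that by auto
  obtain x0 where x0: "x0 \<in> topspace X" "\<not> openin X {x0}"
    using nd discrete_topology_unique[of "topspace X" X] by metis
  obtain F where F: "\<And>f. f \<in> F \<Longrightarrow> continuous_map X euclideanreal f" "\<And>f. f \<in> F \<Longrightarrow> f x0 = 0"
    "\<And>f x. f \<in> F \<Longrightarrow> 0 \<le> f x \<and> f x \<le> 2" "\<And>x. x \<in> topspace X \<Longrightarrow> finite {f \<in> F. f x \<noteq> 0}"
    "\<And>W. openin X W \<Longrightarrow> x0 \<in> W \<Longrightarrow> \<exists>x\<in>W. \<exists>f\<in>F. f x \<ge> 1"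
    using nonisolated_point_bumps[OF reg x0] by blast
  have "\<exists>\<phi>. cont_linear L \<phi> \<and> (\<forall>x\<in>topspace X. \<phi> (i x) = f x)" if "f \<in> F" for f
    by (rule free_lcs_functional[OF L F(1)[OF that]]) blast
  then obtain ext where ext: "\<And>f. f \<in> F \<Longrightarrow> cont_linear L (ext f)"
    "\<And>f x. f \<in> F \<Longrightarrow> x \<in> topspace X \<Longrightarrow> ext f (i x) = f x" by metis
  define \<Phi> where "\<Phi> = ext ` F"
  have cl: "cont_linear L f" if "f \<in> \<Phi>" for f using that ext(1) by (auto simp: \<Phi>_def)
  have lin: "linear_map_on ?V f" if "f \<in> \<Phi>" for f using cl[OF that] by (simp add: cont_linear_def)
  have bd2: "0 \<le> f (i x) \<and> f (i x) \<le> 2" if "f \<in> \<Phi>" "x \<in> topspace X" for f x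
    using that ext(2) F(3) by (auto simp: \<Phi>_def)
  have bd: "pointwise_bounded ?V \<Phi>"
    unfolding free_lcs_span[OF L]
  proof (rule pointwise_bounded_span)
    show "linear_map_on (span (i ` topspace X)) f" if "f \<in> \<Phi>" for f
      using lin[OF that] free_lcs_span[OF L] by simp
    show "\<exists>M. \<forall>f\<in>\<Phi>. \<bar>f b\<bar> \<le> M" if "b \<in> i ` topspace X" for b
      using that bd2 by (intro exI[of _ 2]) fastforce
  qed
  have fin: "finite {f \<in> \<Phi>. f (i x) \<noteq> 0}" if x: "x \<in> topspace X" for x
    by (rule finite_subset[OF _ finite_imageI[OF F(4)[OF x], of ext]]) (use ext(2) x in \<open>auto simp: \<Phi>_def\<close>)
  \<comment> \<open>Otherwise the seminorm ball of radius \<open>1\<close> about \<open>i x0\<close>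
    would pull back along \<open>i\<close> to a neighbourhood of \<open>x0\<close> on which every
    bump is below \<open>1\<close>.\<close>
  have "\<not> finer_than L (refine L \<Phi>)"
  proof
    assume "finer_than L (refine L \<Phi>)"
    then have "openin L {v \<in> ?V. \<exists>d<1. \<forall>f\<in>\<Phi>. \<bar>f (v - i x0)\<bar> \<le> d}"
      using openin_refine_small[OF V lin ix[OF x0(1)]] by (auto simp: finer_than_def)
    moreover have "continuous_map X L i" using L by (simp add: free_lcs_def)
    ultimately have "openin X {x \<in> topspace X. i x \<in> {v \<in> ?V. \<exists>d<1. \<forall>f\<in>\<Phi>. \<bar>f (v - i x0)\<bar> \<le> d}}"
      by (rule openin_continuous_map_preimage[rotated])
    moreover have "x0 \<in> {x \<in> topspace X. i x \<in> {v \<in> ?V. \<exists>d<1. \<forall>f\<in>\<Phi>. \<bar>f (v - i x0)\<bar> \<le> d}}"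
      using x0(1) ix linear_map_on_0[OF V lin] by (auto intro!: exI[of _ 0])
    ultimately have "\<exists>x\<in>{x \<in> topspace X. i x \<in> {v \<in> ?V. \<exists>d<1. \<forall>f\<in>\<Phi>. \<bar>f (v - i x0)\<bar> \<le> d}}. \<exists>f\<in>F. f x \<ge> 1"
      by (rule F(5))
    then obtain x f d where x: "x \<in> topspace X" "d < 1" "\<forall>f\<in>\<Phi>. \<bar>f (i x - i x0)\<bar> \<le> d"
      "f \<in> F" "f x \<ge> 1"
      by blast
    have "ext f (i x - i x0) = f x"
      using linear_map_on_diff[OF lin V ix[OF x(1)] ix[OF x0(1)], of "ext f"] x(1,4) x0(1) ext(2) F(2)
      by (simp add: \<Phi>_def)
    moreover have "\<bar>ext f (i x - i x0)\<bar> \<le> d" using x(3,4) by (auto simp: \<Phi>_def)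
    ultimately show False using x(2,5) by simp
  qed
  moreover have "cont_linear (refine L \<Phi>) g \<longleftrightarrow> cont_linear L g" for g
  proof
    show "cont_linear L g" if "cont_linear (refine L \<Phi>) g"
      by (rule free_lcs_refine_functional[OF L]) (fact cl fin bd2 that)+
  qed (rule cont_linear_refine)
  ultimately show thesis using that[OF cl bd] by simp
qed

lemma topological_dual_eq:
  "topological_dual T = {f \<in> extensional (topspace T). cont_linear T f}"
  by (simp add: topological_dual_def cont_linear_def)

lemma free_lcs_nondiscrete_not_mackey:
  assumes reg: "completely_regular_space X" "Hausdorff_space X" and L: "free_lcs X L i"
    and nd: "X \<noteq> discrete_topology (topspace X)"
  shows "\<not> mackey_space L" and "\<not> mackey_group L"
proof -
  obtain \<Phi> where \<Phi>: "\<And>f. f \<in> \<Phi> \<Longrightarrow> cont_linear L f" and bd: "pointwise_bounded (topspace L) \<Phi>"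
    and dual: "\<And>g. cont_linear (refine L \<Phi>) g \<longleftrightarrow> cont_linear L g" and nf: "\<not> finer_than L (refine L \<Phi>)"
    using free_lcs_nondiscrete_refinement[OF assms] by metis
  note lcs = free_lcs_lcs[OF L]
  have R: "locally_convex_space (refine L \<Phi>)"
    by (rule lcs_refine[OF lcs _ bd]) (use \<Phi> in \<open>simp add: cont_linear_def\<close>)
  have "lcs_compatible L (refine L \<Phi>)"
    using R dual by (simp add: lcs_compatible_def topological_dual_eq)
  then show "\<not> mackey_space L"
    using nf by (auto simp: mackey_space_def is_mackey_topology_def)
  have char: "characters (refine L \<Phi>) = characters L"
    using dual by (simp add: characters_eq[OF R] characters_eq[OF lcs])
  show "\<not> mackey_group L"
  proof
    assume M: "mackey_group L"
    \<comment> \<open>Being a Mackey group includes local quasi-convexity, which passes to the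
      refinement and makes it an admissible competitor.\<close>
    then have "locally_quasi_convex L" by (simp add: mackey_group_def)
    then have "locally_quasi_convex (refine L \<Phi>)"
      by (rule locally_quasi_convex_refine[OF lcs _ \<Phi> bd]) (use char in auto)
    then show False using M char nf by (auto simp: mackey_group_def)
  qed
qed

theorem theorem1p1:
  fixes X :: "'a topology" and L :: "'v::real_vector topology" and i :: "'a \<Rightarrow> 'v"
  assumes "completely_regular_space X" and "Hausdorff_space X"
    and "free_lcs X L i"
  shows "(mackey_group L \<longleftrightarrow> mackey_space L) \<and>
         (mackey_space L \<longleftrightarrow> X = discrete_topology (topspace X))"
  using free_lcs_nondiscrete_not_mackey[OF assms] free_lcs_discrete_mackey_group[OF assms(3)]
    free_lcs_discrete_mackey_space[OF assms(3)] by blast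

end
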